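(* Let $(\Omega,\mathcal A)$ be a measurable space and let $K:\Omega\to\mathcal K'(\mathbb{C}^n)$ be a random compact set in $\mathbb{C}^n$. Then its rationally convex hull $\mathcal R\text{-hull}\,K$, defined pointwise as $[\mathcal R\text{-hull}\,K](\omega):=\mathcal R\text{-hull}\,(K(\omega))$ for $\omega\in\Omega$, is a random compact set.
   Context: $\mathcal K'(\mathbb{C}^n)$ denotes the space of non-empty compact subsets of $\mathbb{C}^n$ with the Hausdorff distance and its Borel $\sigma$-algebra. A random compact set in $\mathbb{C}^n$ is a measurable function $\Omega\to\mathcal K'(\mathbb{C}^n)$. For $Q\in\mathcal K'(\mathbb{C}^n)$, the rationally convex hull is $\mathcal R\text{-hull}\,Q=\{z\in\mathbb{C}^n:|r(z)|\le\max_{x\in Q}|r(x)|\text{ for all }r\in\mathcal R_Q(\mathbb{C}^n)\}$, where $\mathcal R_Q(\mathbb{C}^n)$ is the set of rational functions on $\mathbb{C}^n$ that are holomorphic over $Q$ (i.e. have no singularities on $Q$). *)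

theory Defs
  imports "HOL-Analysis.Analysis"
begin

definition nonempty_compacts :: "'a::metric_space set set" where
  "nonempty_compacts = {A. compact A \<and> A \<noteq> {}}"

text \<open>The value 0 outside the non-empty compact sets is never used; it makes the function
  symmetric and non-negative everywhere, as the locale \<open>Metric_space\<close> asks for.\<close>

definition hausdorff_dist :: "'a::metric_space set \<Rightarrow> 'a set \<Rightarrow> real" where
  "hausdorff_dist A B =
     (if A \<in> nonempty_compacts \<and> B \<in> nonempty_compacts
      then max (SUP x\<in>A. infdist x B) (SUP y\<in>B. infdist y A) else 0)"

lemma bdd_above_infdist:
  fixes A B :: "'a::metric_space set"
  assumes "compact A"
  shows "bdd_above ((\<lambda>x. infdist x B) ` A)"
  by (intro bounded_imp_bdd_above compact_imp_bounded compact_continuous_image assms)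
     (intro continuous_intros)

lemma infdist_le_hausdorff_dist:
  assumes "A \<in> nonempty_compacts" "B \<in> nonempty_compacts" "x \<in> A"
  shows "infdist x B \<le> hausdorff_dist A B"
proof -
  have "infdist x B \<le> (SUP x\<in>A. infdist x B)"
    using assms by (intro cSUP_upper bdd_above_infdist) (auto simp: nonempty_compacts_def)
  then show ?thesis using assms by (simp add: hausdorff_dist_def)
qed

lemma hausdorff_dist_commute: "hausdorff_dist A B = hausdorff_dist B A"
  by (simp add: hausdorff_dist_def max.commute conj_commute)

lemma hausdorff_dist_le:
  assumes "A \<in> nonempty_compacts" "B \<in> nonempty_compacts"
    and "\<And>x. x \<in> A \<Longrightarrow> infdist x B \<le> e" "\<And>y. y \<in> B \<Longrightarrow> infdist y A \<le> e"
  shows "hausdorff_dist A B \<le> e"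
  using assms by (auto simp: hausdorff_dist_def nonempty_compacts_def intro!: cSUP_least)

lemma infdist_hausdorff_triangle:
  assumes A: "A \<in> nonempty_compacts" and B: "B \<in> nonempty_compacts"
    and C: "C \<in> nonempty_compacts" and x: "x \<in> A"
  shows "infdist x C \<le> hausdorff_dist A B + hausdorff_dist B C"
proof -
  have B': "compact B" "B \<noteq> {}" using B by (auto simp: nonempty_compacts_def)
  then obtain y where y: "y \<in> B" "\<And>b. b \<in> B \<Longrightarrow> dist x y \<le> dist x b"
    using continuous_attains_inf[of B "dist x"] continuous_on_dist[OF continuous_on_const continuous_on_id]
    by blast
  then have "dist x y \<le> infdist x B"
    using B' by (auto simp: infdist_notempty intro: cINF_greatest)
  have "infdist x C \<le> infdist y C + dist x y" by (rule infdist_triangle)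
  moreover have "dist x y \<le> hausdorff_dist A B"
    using infdist_le_hausdorff_dist[OF A B x] \<open>dist x y \<le> infdist x B\<close> by simp
  moreover have "infdist y C \<le> hausdorff_dist B C"
    using infdist_le_hausdorff_dist[OF B C] y by simp
  ultimately show ?thesis by linarith
qed

lemma Metric_space_hausdorff_dist: "Metric_space nonempty_compacts hausdorff_dist"
proof
  fix A B :: "'a set"
  show nn: "0 \<le> hausdorff_dist A B"
  proof (cases "A \<in> nonempty_compacts \<and> B \<in> nonempty_compacts")
    case True
    then obtain x where "x \<in> A" by (auto simp: nonempty_compacts_def)
    then show ?thesis
      using infdist_le_hausdorff_dist[of A B x] True infdist_nonneg[of x B] by linarith
  qed (auto simp: hausdorff_dist_def)
  show "hausdorff_dist A B = hausdorff_dist B A" by (rule hausdorff_dist_commute)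
  assume AB: "A \<in> nonempty_compacts" "B \<in> nonempty_compacts"
  have sub: "A' \<subseteq> B'" if "hausdorff_dist A' B' = 0" "A' \<in> nonempty_compacts" "B' \<in> nonempty_compacts"
    for A' B' :: "'a set"
  proof
    fix x assume "x \<in> A'"
    then have "infdist x B' = 0"
      using infdist_le_hausdorff_dist[of A' B' x] that infdist_nonneg[of x B'] by simp
    then show "x \<in> B'"
      using that in_closed_iff_infdist_zero[of B' x] compact_imp_closed
      by (auto simp: nonempty_compacts_def)
  qed
  show "hausdorff_dist A B = 0 \<longleftrightarrow> A = B"
  proof
    assume "hausdorff_dist A B = 0"
    then show "A = B" using sub[of A B] sub[of B A] AB hausdorff_dist_commute[of A B] by auto
  next
    assume "A = B"
    then show "hausdorff_dist A B = 0"
      using nn hausdorff_dist_le[OF AB, of 0] by simp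
  qed
next
  fix A B C :: "'a set"
  assume A: "A \<in> nonempty_compacts" and B: "B \<in> nonempty_compacts" and C: "C \<in> nonempty_compacts"
  show "hausdorff_dist A C \<le> hausdorff_dist A B + hausdorff_dist B C"
    using infdist_hausdorff_triangle[OF A B C] infdist_hausdorff_triangle[OF C B A]
    by (intro hausdorff_dist_le A C)
       (auto simp: hausdorff_dist_commute[of C] hausdorff_dist_commute[of B A] add.commute)
qed

definition hausdorff_borel :: "'a::metric_space set measure" where
  "hausdorff_borel =
     sigma nonempty_compacts {\<U>. openin (Metric_space.mtopology nonempty_compacts hausdorff_dist) \<U>}"

lemma space_hausdorff_borel: "space hausdorff_borel = nonempty_compacts"
  by (simp add: hausdorff_borel_def space_measure_of_conv)

text \<open>Only the \<open>\<sigma>\<close>-algebra of \<open>M\<close> matters here, its measure plays no role. Since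
  \<open>space hausdorff_borel = nonempty_compacts\<close>, the condition includes that every value
  \<open>K \<omega>\<close> with \<open>\<omega> \<in> space M\<close> is compact and non-empty.\<close>

definition random_compact_set :: "'w measure \<Rightarrow> ('w \<Rightarrow> 'a::metric_space set) \<Rightarrow> bool" where
  "random_compact_set M K \<longleftrightarrow> K \<in> measurable M hausdorff_borel"

definition polynomial_on_Cn :: "(complex ^ 'n::finite \<Rightarrow> complex) \<Rightarrow> bool" where
  "polynomial_on_Cn p \<longleftrightarrow>
     (\<exists>(S :: ('n \<Rightarrow> nat) set) c. finite S \<and> p = (\<lambda>z. \<Sum>\<alpha>\<in>S. c \<alpha> * (\<Prod>i\<in>UNIV. (z $ i) ^ \<alpha> i)))"

text \<open>Holomorphy in several variables: a complex linear Frechet derivative exists at every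
  point. (The library notion \<open>holomorphic_on\<close> is restricted to one variable.)\<close>

definition holomorphic_on_Cn :: "(complex ^ 'n::finite \<Rightarrow> complex) \<Rightarrow> (complex ^ 'n) set \<Rightarrow> bool" where
  "holomorphic_on_Cn h U \<longleftrightarrow>
     (\<forall>x\<in>U. \<exists>D. (h has_derivative D) (at x) \<and> (\<forall>c v. D (c *s v) = c * D v))"

text \<open>The quotient \<open>p / q\<close> has no singularity at \<open>x\<close> and takes the value \<open>w\<close> there: it extends
  from the points with \<open>q \<noteq> 0\<close> to a holomorphic function near \<open>x\<close>.\<close>

definition quotient_has_value ::
    "(complex ^ 'n::finite \<Rightarrow> complex) \<Rightarrow> (complex ^ 'n \<Rightarrow> complex) \<Rightarrow> complex ^ 'n \<Rightarrow> complex \<Rightarrow> bool" where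
  "quotient_has_value p q x w \<longleftrightarrow>
     (\<exists>U h. open U \<and> x \<in> U \<and> holomorphic_on_Cn h U \<and>
            (\<forall>y\<in>U. q y \<noteq> 0 \<longrightarrow> h y = p y / q y) \<and> h x = w)"

text \<open>A rational function is a quotient of two polynomials whose denominator is not the zero
  polynomial. It is modelled as a partial function that is undefined exactly at its singularities, so
  that its domain does not depend on the chosen numerator and denominator
  (\<open>x \<cdot> x / x\<close> is the polynomial \<open>x\<close>).\<close>

definition rational_functions :: "(complex ^ 'n::finite \<rightharpoonup> complex) set" where
  "rational_functions =
     {r. \<exists>p q. polynomial_on_Cn p \<and> polynomial_on_Cn q \<and> q \<noteq> (\<lambda>z. 0) \<and>
               (\<forall>x w. r x = Some w \<longleftrightarrow> quotient_has_value p q x w)}"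

definition rational_functions_over :: "(complex ^ 'n::finite) set \<Rightarrow> (complex ^ 'n \<rightharpoonup> complex) set" where
  "rational_functions_over Q = {r \<in> rational_functions. Q \<subseteq> dom r}"

text \<open>At a singularity \<open>z\<close> of \<open>r\<close> the inequality \<open>\<bar>r z\<bar> \<le> max \<bar>r\<bar>\<close> counts as false (\<open>\<bar>r z\<bar> = \<infinity>\<close>).
  For a non-empty compact \<open>Q\<close> the supremum is the maximum, as \<open>r\<close> is continuous on \<open>Q\<close>.\<close>

definition rational_hull :: "(complex ^ 'n::finite) set \<Rightarrow> (complex ^ 'n) set" where
  "rational_hull Q =
     {z. \<forall>r \<in> rational_functions_over Q.
           z \<in> dom r \<and> norm (the (r z)) \<le> (SUP x\<in>Q. norm (the (r x)))}"

text \<open>Any two polynomials, the second one not zero, do define a rational function, because the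
  value at a point is unique.\<close>

lemma polynomial_on_Cn_line:
  assumes "polynomial_on_Cn q"
  shows "\<exists>P. \<forall>t. poly P t = q (x + t *s v)"
proof -
  obtain S c where S: "finite S" "q = (\<lambda>z. \<Sum>\<alpha>\<in>S. c \<alpha> * (\<Prod>i\<in>UNIV. (z $ i) ^ \<alpha> i))"
    using assms unfolding polynomial_on_Cn_def by blast
  let ?P = "\<Sum>\<alpha>\<in>S. smult (c \<alpha>) (\<Prod>i\<in>UNIV. [:x $ i, v $ i:] ^ \<alpha> i)"
  have "poly ?P t = q (x + t *s v)" for t
    by (simp add: S(2) poly_sum poly_prod)
  then show ?thesis by blast
qed

lemma polynomial_on_Cn_nonzero_dense:
  assumes q: "polynomial_on_Cn q" "q \<noteq> (\<lambda>z. 0)" and U: "open U" "x \<in> U"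
  shows "\<exists>y\<in>U. q y \<noteq> 0"
proof -
  obtain z where z: "q z \<noteq> 0" using q(2) by auto
  obtain P where P: "poly P t = q (x + t *s (z - x))" for t
    using polynomial_on_Cn_line[OF q(1)] by metis
  have "poly P 1 \<noteq> 0" using z by (simp add: P)
  then have "finite {t. poly P t = 0}" using poly_roots_finite[of P] by (cases "P = 0") simp_all
  then have fin: "finite {s::real. poly P (of_real s) = 0}"
    using finite_vimageI[of "{t. poly P t = 0}" "of_real :: real \<Rightarrow> complex"]
    by (simp add: vimage_def inj_of_real)
  have "((\<lambda>s::real. x + s *\<^sub>R (z - x)) \<longlongrightarrow> x + 0 *\<^sub>R (z - x)) (at 0)"
    by (intro tendsto_intros)
  then have "\<forall>\<^sub>F s in at (0::real). x + s *\<^sub>R (z - x) \<in> U"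
    using U by (intro topological_tendstoD) auto
  moreover have "\<forall>\<^sub>F s in at (0::real). s \<notin> {s. poly P (of_real s) = 0}"
    using islimpt_finite[OF fin, of 0] by (simp add: islimpt_iff_eventually)
  ultimately have "\<forall>\<^sub>F s in at (0::real). x + s *\<^sub>R (z - x) \<in> U \<and> poly P (of_real s) \<noteq> 0"
    by eventually_elim auto
  then obtain s :: real where s: "x + s *\<^sub>R (z - x) \<in> U" "poly P (of_real s) \<noteq> 0"
    using eventually_happens'[OF trivial_limit_at] by blast
  have "complex_of_real s *s (z - x) = s *\<^sub>R (z - x)"
    unfolding vec_eq_iff vector_scaleR_component vector_smult_component
    by (simp add: scaleR_conv_of_real)
  then show ?thesis using s P[of "complex_of_real s"] by auto
qed

lemma quotient_has_value_unique:
  assumes q: "polynomial_on_Cn q" "q \<noteq> (\<lambda>z. 0)"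
    and "quotient_has_value p q x w" "quotient_has_value p q x w'"
  shows "w = w'"
proof (rule ccontr)
  assume ne: "w \<noteq> w'"
  obtain U h where U: "open U" "x \<in> U" "holomorphic_on_Cn h U"
    "\<And>y. y \<in> U \<Longrightarrow> q y \<noteq> 0 \<Longrightarrow> h y = p y / q y" "h x = w"
    using assms(3) unfolding quotient_has_value_def by blast
  obtain V k where V: "open V" "x \<in> V" "holomorphic_on_Cn k V"
    "\<And>y. y \<in> V \<Longrightarrow> q y \<noteq> 0 \<Longrightarrow> k y = p y / q y" "k x = w'"
    using assms(4) unfolding quotient_has_value_def by blast
  have "continuous_on (U \<inter> V) h" "continuous_on (U \<inter> V) k"
    using U(3) V(3) unfolding holomorphic_on_Cn_def
    by (intro continuous_at_imp_continuous_on ballI; blast dest: has_derivative_continuous)+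
  then have "continuous_on (U \<inter> V) (\<lambda>y. h y - k y)" by (intro continuous_intros)
  then have "open ((U \<inter> V) \<inter> (\<lambda>y. h y - k y) -` (- {0}))"
    using U V by (intro continuous_open_preimage) auto
  moreover have "x \<in> (U \<inter> V) \<inter> (\<lambda>y. h y - k y) -` (- {0})"
    using U V ne by auto
  ultimately obtain y where "y \<in> (U \<inter> V) \<inter> (\<lambda>y. h y - k y) -` (- {0})" "q y \<noteq> 0"
    using polynomial_on_Cn_nonzero_dense[OF q] by blast
  then show False using U(4)[of y] V(4)[of y] by auto
qed

lemma rational_function_exists:
  assumes "polynomial_on_Cn p" "polynomial_on_Cn q" "q \<noteq> (\<lambda>z. 0)"
  shows "\<exists>r\<in>rational_functions. \<forall>x w. r x = Some w \<longleftrightarrow> quotient_has_value p q x w"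
proof -
  define r where "r = (\<lambda>x. if \<exists>w. quotient_has_value p q x w
                          then Some (SOME w. quotient_has_value p q x w) else None)"
  have "r x = Some w \<longleftrightarrow> quotient_has_value p q x w" for x w
  proof (cases "\<exists>w. quotient_has_value p q x w")
    case True
    then have "quotient_has_value p q x (SOME w. quotient_has_value p q x w)" by (rule someI_ex)
    then show ?thesis
      using True quotient_has_value_unique[OF assms(2,3)] unfolding r_def by (metis option.inject)
  next
    case False
    then show ?thesis by (auto simp: r_def)
  qed
  then show ?thesis
    unfolding rational_functions_def using assms by blast
qed

end

theory Submission
  imports Defs "HOL-Computational_Algebra.Fundamental_Theorem_Algebra"
begin

text \<open>A point \<open>z\<close> lies in the rationally convex hull of \<open>Q\<close> iff \<open>f z \<in> f ` Q\<close> for every polynomial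
  \<open>f\<close>. If \<open>f z \<notin> f ` Q\<close>, then \<open>1 / (f - f z)\<close> is defined on \<open>Q\<close> but not at \<open>z\<close>. Conversely, write a
  rational function without singularities on \<open>Q\<close> in lowest terms \<open>p / q\<close>, so that \<open>q\<close> has no zero on
  \<open>Q\<close>, and apply the condition to \<open>q\<close> and to \<open>p - w q\<close> with \<open>w = p z / q z\<close>. The condition
  \<open>f z \<in> f ` Q\<close> is closed in \<open>(z, Q)\<close>, so the hull depends upper semicontinuously on \<open>Q\<close>: for closed
  \<open>C\<close> the sets whose hull misses \<open>C\<close> form an open set. Events of this kind generate the Borel
  \<open>\<sigma>\<close>-algebra of the Hausdorff distance.\<close>

subsection \<open>The ring of polynomial functions\<close>

text \<open>Equal exponents are collected into one coefficient. The free index set \<open>J\<close>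
  lets sums and products of polynomials be indexed by disjoint unions and by pairs.\<close>

lemma polynomial_on_Cn_sum_monomials:
  fixes a :: "'j \<Rightarrow> 'n::finite \<Rightarrow> nat"
  assumes "finite J"
  shows "polynomial_on_Cn (\<lambda>z :: complex ^ 'n. \<Sum>j\<in>J. c j * (\<Prod>i\<in>UNIV. (z $ i) ^ a j i))"
proof -
  have "(\<Sum>j\<in>J. c j * (\<Prod>i\<in>UNIV. (z $ i) ^ a j i)) =
      (\<Sum>\<alpha>\<in>a ` J. (\<Sum>j\<in>{j\<in>J. a j = \<alpha>}. c j) * (\<Prod>i\<in>UNIV. (z $ i) ^ \<alpha> i))" for z :: "complex ^ 'n"
    unfolding sum.image_gen[OF assms, of _ a] sum_distrib_right by (intro sum.cong) auto
  then show ?thesis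
    unfolding polynomial_on_Cn_def using assms
    by (intro exI[of _ "a ` J"] exI[of _ "\<lambda>\<alpha>. \<Sum>j\<in>{j\<in>J. a j = \<alpha>}. c j"] conjI finite_imageI ext)
qed

lemma polynomial_on_Cn_const: "polynomial_on_Cn (\<lambda>z. c)"
  using polynomial_on_Cn_sum_monomials[of "{()}" "\<lambda>_. c" "\<lambda>_ _. 0"] by simp

lemma polynomial_on_Cn_component: "polynomial_on_Cn (\<lambda>z :: complex ^ 'n::finite. z $ i)"
proof -
  have "(\<Prod>k\<in>UNIV. (z $ k) ^ (if k = i then 1 else 0)) = (\<Prod>k\<in>UNIV. if k = i then z $ k else 1)"
    for z :: "complex ^ 'n"
    by (rule prod.cong) simp_all
  then have "(\<Prod>k\<in>UNIV. (z $ k) ^ (if k = i then 1 else 0)) = z $ i" for z :: "complex ^ 'n"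
    by simp
  then show ?thesis
    using polynomial_on_Cn_sum_monomials[of "{()}" "\<lambda>_. 1" "\<lambda>_ k. if k = i then 1 else 0 :: nat"]
    by (simp only: sum.insert sum.empty finite.intros empty_iff simp_thms mult_1 add_0_right)
qed

lemma polynomial_on_Cn_add:
  assumes "polynomial_on_Cn p" "polynomial_on_Cn q"
  shows "polynomial_on_Cn (\<lambda>z. p z + q z)"
proof -
  obtain S c where p: "finite S" "p = (\<lambda>z. \<Sum>\<alpha>\<in>S. c \<alpha> * (\<Prod>i\<in>UNIV. (z $ i) ^ \<alpha> i))"
    using assms(1) unfolding polynomial_on_Cn_def by blast
  obtain T d where q: "finite T" "q = (\<lambda>z. \<Sum>\<alpha>\<in>T. d \<alpha> * (\<Prod>i\<in>UNIV. (z $ i) ^ \<alpha> i))"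
    using assms(2) unfolding polynomial_on_Cn_def by blast
  show ?thesis
    using polynomial_on_Cn_sum_monomials[of "S <+> T" "case_sum c d" "case_sum (\<lambda>\<alpha>. \<alpha>) (\<lambda>\<alpha>. \<alpha>)"] p q
    by (simp add: sum.Plus)
qed

lemma polynomial_on_Cn_mult:
  assumes "polynomial_on_Cn p" "polynomial_on_Cn q"
  shows "polynomial_on_Cn (\<lambda>z. p z * q z)"
proof -
  obtain S c where p: "finite S" "p = (\<lambda>z. \<Sum>\<alpha>\<in>S. c \<alpha> * (\<Prod>i\<in>UNIV. (z $ i) ^ \<alpha> i))"
    using assms(1) unfolding polynomial_on_Cn_def by blast
  obtain T d where q: "finite T" "q = (\<lambda>z. \<Sum>\<alpha>\<in>T. d \<alpha> * (\<Prod>i\<in>UNIV. (z $ i) ^ \<alpha> i))"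
    using assms(2) unfolding polynomial_on_Cn_def by blast
  have "p z * q z = (\<Sum>j\<in>S \<times> T. (c (fst j) * d (snd j)) * (\<Prod>i\<in>UNIV. (z $ i) ^ (fst j i + snd j i)))" for z
    unfolding p q
    by (simp add: sum_product sum.cartesian_product power_add prod.distrib mult_ac case_prod_beta)
  then show ?thesis
    using polynomial_on_Cn_sum_monomials[of "S \<times> T" "\<lambda>j. c (fst j) * d (snd j)" "\<lambda>j i. fst j i + snd j i"]
      p(1) q(1) by simp
qed

lemma polynomial_on_Cn_uminus:
  assumes "polynomial_on_Cn p"
  shows "polynomial_on_Cn (\<lambda>z. - p z)"
  using polynomial_on_Cn_mult[OF polynomial_on_Cn_const[of "-1"] assms] by simp

lemma polynomial_on_Cn_diff:
  assumes "polynomial_on_Cn p" "polynomial_on_Cn q"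
  shows "polynomial_on_Cn (\<lambda>z. p z - q z)"
  using polynomial_on_Cn_add[OF assms(1) polynomial_on_Cn_uminus[OF assms(2)]] by simp

lemma continuous_on_polynomial_on_Cn:
  assumes "polynomial_on_Cn p"
  shows "continuous_on A p"
proof -
  obtain S c where "p = (\<lambda>z. \<Sum>\<alpha>\<in>S. c \<alpha> * (\<Prod>i\<in>UNIV. (z $ i) ^ \<alpha> i))"
    using assms unfolding polynomial_on_Cn_def by blast
  then show ?thesis by (auto intro!: continuous_intros)
qed

section \<open>Closure properties of holomorphic functions of several variables\<close>

lemma holomorphic_on_Cn_continuous_on:
  assumes "holomorphic_on_Cn h U"
  shows "continuous_on U h"
  using assms unfolding holomorphic_on_Cn_def
  by (intro continuous_at_imp_continuous_on ballI) (blast dest: has_derivative_continuous)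

lemma holomorphic_on_Cn_const: "holomorphic_on_Cn (\<lambda>z. c) U"
  unfolding holomorphic_on_Cn_def by (intro ballI exI[of _ "\<lambda>_. 0"]) auto

lemma holomorphic_on_Cn_component: "holomorphic_on_Cn (\<lambda>z. z $ i) U"
  unfolding holomorphic_on_Cn_def
  by (intro ballI exI[of _ "\<lambda>v. v $ i"])
     (auto intro: bounded_linear_imp_has_derivative bounded_linear_vec_nth)

lemma holomorphic_on_Cn_add:
  assumes "holomorphic_on_Cn f U" "holomorphic_on_Cn g U"
  shows "holomorphic_on_Cn (\<lambda>z. f z + g z) U"
  unfolding holomorphic_on_Cn_def
proof
  fix x assume "x \<in> U"
  then obtain D E where "(f has_derivative D) (at x)" "\<forall>c v. D (c *s v) = c * D v"
    "(g has_derivative E) (at x)" "\<forall>c v. E (c *s v) = c * E v"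
    using assms unfolding holomorphic_on_Cn_def by meson
  then show "\<exists>D. ((\<lambda>z. f z + g z) has_derivative D) (at x) \<and> (\<forall>c v. D (c *s v) = c * D v)"
    by (intro exI[of _ "\<lambda>v. D v + E v"]) (auto intro: has_derivative_add simp: algebra_simps)
qed

lemma holomorphic_on_Cn_mult:
  assumes "holomorphic_on_Cn f U" "holomorphic_on_Cn g U"
  shows "holomorphic_on_Cn (\<lambda>z. f z * g z) U"
  unfolding holomorphic_on_Cn_def
proof
  fix x assume "x \<in> U"
  then obtain D E where "(f has_derivative D) (at x)" "\<forall>c v. D (c *s v) = c * D v"
    "(g has_derivative E) (at x)" "\<forall>c v. E (c *s v) = c * E v"
    using assms unfolding holomorphic_on_Cn_def by meson
  then show "\<exists>D. ((\<lambda>z. f z * g z) has_derivative D) (at x) \<and> (\<forall>c v. D (c *s v) = c * D v)"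
    by (intro exI[of _ "\<lambda>v. f x * E v + D v * g x"] conjI has_derivative_mult)
       (simp_all add: algebra_simps)
qed

lemma holomorphic_on_Cn_divide:
  assumes "holomorphic_on_Cn f U" "holomorphic_on_Cn g U" "\<And>x. x \<in> U \<Longrightarrow> g x \<noteq> 0"
  shows "holomorphic_on_Cn (\<lambda>z. f z / g z) U"
  unfolding holomorphic_on_Cn_def
proof
  fix x assume "x \<in> U"
  then obtain D E where "(f has_derivative D) (at x)" "\<forall>c v. D (c *s v) = c * D v"
    "(g has_derivative E) (at x)" "\<forall>c v. E (c *s v) = c * E v" "g x \<noteq> 0"
    using assms unfolding holomorphic_on_Cn_def by meson
  then show "\<exists>D. ((\<lambda>z. f z / g z) has_derivative D) (at x) \<and> (\<forall>c v. D (c *s v) = c * D v)"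
    by (intro exI[of _ "\<lambda>v. (D v * g x - f x * E v) / (g x * g x)"] conjI has_derivative_divide')
       (simp_all add: algebra_simps diff_divide_distrib)
qed

lemma holomorphic_on_Cn_sum:
  assumes "\<And>i. i \<in> I \<Longrightarrow> holomorphic_on_Cn (f i) U"
  shows "holomorphic_on_Cn (\<lambda>z. \<Sum>i\<in>I. f i z) U"
  using assms
  by (induction I rule: infinite_finite_induct)
     (auto intro: holomorphic_on_Cn_add holomorphic_on_Cn_const)

lemma holomorphic_on_Cn_prod:
  assumes "\<And>i. i \<in> I \<Longrightarrow> holomorphic_on_Cn (f i) U"
  shows "holomorphic_on_Cn (\<lambda>z. \<Prod>i\<in>I. f i z) U"
  using assms
  by (induction I rule: infinite_finite_induct)
     (auto intro: holomorphic_on_Cn_mult holomorphic_on_Cn_const)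

lemma holomorphic_on_Cn_power:
  assumes "holomorphic_on_Cn f U"
  shows "holomorphic_on_Cn (\<lambda>z. f z ^ k) U"
  using assms by (induction k) (auto intro: holomorphic_on_Cn_mult holomorphic_on_Cn_const)

lemma holomorphic_on_Cn_polynomial:
  assumes "polynomial_on_Cn p"
  shows "holomorphic_on_Cn p U"
proof -
  obtain S c where "p = (\<lambda>z. \<Sum>\<alpha>\<in>S. c \<alpha> * (\<Prod>i\<in>UNIV. (z $ i) ^ \<alpha> i))"
    using assms unfolding polynomial_on_Cn_def by blast
  then show ?thesis
    by (auto intro!: holomorphic_on_Cn_sum holomorphic_on_Cn_mult holomorphic_on_Cn_const
        holomorphic_on_Cn_prod holomorphic_on_Cn_power holomorphic_on_Cn_component)
qed

text \<open>Polynomial functions become a type of their own, so that \<open>'n cn_poly poly\<close>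
  and pseudo-division over an integral domain are available.\<close>

typedef (overloaded) ('n::finite) cn_poly = "{p :: complex ^ 'n \<Rightarrow> complex. polynomial_on_Cn p}"
  morphisms peval cn_poly
  using polynomial_on_Cn_const by blast

lemma polynomial_on_Cn_peval: "polynomial_on_Cn (peval f)"
  using peval by blast

lemma peval_cn_poly: "polynomial_on_Cn p \<Longrightarrow> peval (cn_poly p) = p"
  by (simp add: cn_poly_inverse)

lemma cn_poly_eqI: "(\<And>z. peval f z = peval g z) \<Longrightarrow> f = g"
  using peval_inject by blast

instantiation cn_poly :: (finite) comm_ring_1
begin

definition "0 = cn_poly (\<lambda>z. 0)"
definition "1 = cn_poly (\<lambda>z. 1)"
definition "f + g = cn_poly (\<lambda>z. peval f z + peval g z)"
definition "f - g = cn_poly (\<lambda>z. peval f z - peval g z)"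
definition "f * g = cn_poly (\<lambda>z. peval f z * peval g z)"
definition "- f = cn_poly (\<lambda>z. - peval f z)"

lemma peval_simps [simp]:
  "peval 0 z = 0" "peval 1 z = 1" "peval (f + g) z = peval f z + peval g z"
  "peval (f - g) z = peval f z - peval g z" "peval (f * g) z = peval f z * peval g z"
  "peval (- f) z = - peval f z"
  by (simp_all add: zero_cn_poly_def one_cn_poly_def plus_cn_poly_def minus_cn_poly_def
      times_cn_poly_def uminus_cn_poly_def peval_cn_poly polynomial_on_Cn_const polynomial_on_Cn_add
      polynomial_on_Cn_diff polynomial_on_Cn_mult polynomial_on_Cn_uminus polynomial_on_Cn_peval)

instance
proof
  have "peval (0 :: 'a cn_poly) 0 \<noteq> peval 1 0" by simp
  then show "(0 :: 'a cn_poly) \<noteq> 1" by metis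
qed (rule cn_poly_eqI, simp add: ring_distribs add_ac mult_ac)+

end

lemma peval_nonzero_dense:
  assumes "f \<noteq> 0" "open U" "x \<in> U"
  shows "\<exists>y\<in>U. peval f y \<noteq> 0"
proof (rule polynomial_on_Cn_nonzero_dense[OF polynomial_on_Cn_peval _ assms(2,3)])
  show "peval f \<noteq> (\<lambda>z. 0)"
    using assms(1) cn_poly_eqI[of f 0] by auto
qed

lemma continuous_on_peval: "continuous_on A (peval f)"
  by (intro continuous_on_polynomial_on_Cn polynomial_on_Cn_peval)

text \<open>The points where \<open>f\<close> is nonzero form a nonempty open set, and a nonzero
  \<open>g\<close> cannot vanish throughout such a set.\<close>

instance cn_poly :: (finite) idom
proof
  fix f g :: "'a cn_poly"
  assume f: "f \<noteq> 0" and g: "g \<noteq> 0"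
  have "open (peval f -` (- {0}))"
    using continuous_on_peval by (intro open_vimage) auto
  moreover obtain x where "peval f x \<noteq> 0"
    using peval_nonzero_dense[OF f open_UNIV] by blast
  ultimately obtain y where "peval f y \<noteq> 0" "peval g y \<noteq> 0"
    using peval_nonzero_dense[OF g, of "peval f -` (- {0})" x] by auto
  then have "peval (f * g) y \<noteq> peval 0 y" by simp
  then show "f * g \<noteq> 0" by metis
qed

lemma peval_sum [simp]: "peval (sum f A) z = (\<Sum>i\<in>A. peval (f i) z)"
  by (induction A rule: infinite_finite_induct) auto

lemma peval_prod [simp]: "peval (prod f A) z = (\<Prod>i\<in>A. peval (f i) z)"
  by (induction A rule: infinite_finite_induct) auto

lemma peval_power [simp]: "peval (f ^ k) z = peval f z ^ k"
  by (induction k) auto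

definition Const :: "complex \<Rightarrow> ('n::finite) cn_poly" where
  "Const c = cn_poly (\<lambda>z. c)"

definition Var :: "'n \<Rightarrow> ('n::finite) cn_poly" where
  "Var i = cn_poly (\<lambda>z. z $ i)"

lemma peval_Const [simp]: "peval (Const c) z = c"
  by (simp add: Const_def peval_cn_poly polynomial_on_Cn_const)

lemma peval_Var [simp]: "peval (Var i) z = z $ i"
  by (simp add: Var_def peval_cn_poly polynomial_on_Cn_component)

lemma Const_simps [simp]: "Const 0 = 0" "Const 1 = 1"
  by (auto intro: cn_poly_eqI)

lemma Const_eq_0_iff [simp]: "(Const c :: ('a::finite) cn_poly) = 0 \<longleftrightarrow> c = 0"
proof
  assume "(Const c :: 'a cn_poly) = 0"
  then have "peval (Const c :: 'a cn_poly) 0 = peval 0 0" by simp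
  then show "c = 0" by simp
qed simp

subsection \<open>Restriction to lines\<close>

text \<open>A polynomial over \<open>cn_poly\<close> is a family of complex polynomials in
  \<open>t\<close> whose coefficients depend polynomially on a base point; \<open>spec F z\<close>
  is the member at \<open>z\<close>. In use, \<open>t\<close> runs along the line through
  \<open>z\<close> in a fixed direction.\<close>

definition spec :: "('n::finite) cn_poly poly \<Rightarrow> complex ^ 'n \<Rightarrow> complex poly" where
  "spec F z = map_poly (\<lambda>a. peval a z) F"

lemma coeff_spec [simp]: "coeff (spec F z) i = peval (coeff F i) z"
  by (simp add: spec_def coeff_map_poly)

lemma spec_simps [simp]:
  "spec 0 z = 0" "spec (F + G) z = spec F z + spec G z" "spec (F * G) z = spec F z * spec G z"
  "spec (smult a F) z = smult (peval a z) (spec F z)" "spec [:a:] z = [:peval a z:]"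
  by (auto intro!: poly_eqI simp: coeff_mult coeff_pCons split: nat.split)

lemma poly_spec: "poly (spec F z) t = peval (poly F (Const t)) z"
  by (induction F) (simp_all add: spec_def map_poly_pCons)

lemma spec_eqD:
  assumes "\<And>z. spec F z = spec G z"
  shows "F = G"
proof (intro poly_eqI cn_poly_eqI)
  fix i z
  show "peval (coeff F i) z = peval (coeff G i) z"
    using assms[of z] coeff_spec by metis
qed

lemma degree_spec_le: "degree (spec F z) \<le> degree F"
  by (intro degree_le) (simp add: coeff_eq_0)

lemma degree_spec:
  assumes "peval (lead_coeff F) z \<noteq> 0"
  shows "degree (spec F z) = degree F"
  using assms by (intro antisym degree_spec_le le_degree) simp

text \<open>Each component \<open>z $ i + t * v $ i\<close> is linear in \<open>t\<close> with
  coefficients \<open>Var i\<close> and \<open>Const (v $ i)\<close>. A single \<open>F\<close>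
  serves all base points, so algebra over \<open>cn_poly\<close> treats all parallel lines at
  once.\<close>

lemma line_expansion:
  fixes f :: "('n::finite) cn_poly"
  shows "\<exists>F. \<forall>z t. poly (spec F z) t = peval f (z + t *s v)"
proof -
  obtain S c where S: "finite S" "peval f = (\<lambda>z. \<Sum>\<alpha>\<in>S. c \<alpha> * (\<Prod>i\<in>UNIV. (z $ i) ^ \<alpha> i))"
    using polynomial_on_Cn_peval[of f] unfolding polynomial_on_Cn_def by blast
  let ?F = "\<Sum>\<alpha>\<in>S. smult (Const (c \<alpha>)) (\<Prod>i\<in>UNIV. [:Var i, Const (v $ i):] ^ \<alpha> i)"
  have "poly (spec ?F z) t = peval f (z + t *s v)" for z t
    by (simp add: S(2) poly_spec poly_sum poly_prod)
  then show ?thesis by blast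
qed

text \<open>Degree bounds take the place of exact degrees, since a factor such as
  \<open>[:Var i, Const (v $ i):]\<close> drops in degree when \<open>v $ i = 0\<close>.\<close>

lemma coeff_mult_top:
  fixes p q :: "'a::comm_semiring_0 poly"
  assumes "degree p \<le> m" "degree q \<le> n"
  shows "coeff (p * q) (m + n) = coeff p m * coeff q n"
proof -
  have "coeff p i * coeff q (m + n - i) = 0" if "i \<le> m + n" "i \<noteq> m" for i
    using that assms by (cases "i < m") (auto simp: coeff_eq_0)
  then have "coeff (p * q) (m + n) = (\<Sum>i\<le>m + n. if i = m then coeff p m * coeff q n else 0)"
    unfolding coeff_mult by (intro sum.cong) auto
  then show ?thesis by simp
qed

lemma coeff_power_top:
  fixes p :: "'a::comm_semiring_1 poly"
  assumes "degree p \<le> 1"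
  shows "degree (p ^ k) \<le> k \<and> coeff (p ^ k) k = coeff p 1 ^ k"
proof (induction k)
  case (Suc k)
  then show ?case
    using assms degree_mult_le[of p "p ^ k"] coeff_mult_top[of p 1 "p ^ k" k] by simp
qed simp

lemma coeff_prod_top:
  fixes p :: "'i \<Rightarrow> 'a::comm_semiring_1 poly"
  assumes "\<And>i. i \<in> I \<Longrightarrow> degree (p i) \<le> m i"
  shows "degree (prod p I) \<le> sum m I \<and> coeff (prod p I) (sum m I) = (\<Prod>i\<in>I. coeff (p i) (m i))"
  using assms
proof (induction I rule: infinite_finite_induct)
  case (insert i I)
  then show ?case
    using degree_mult_le[of "p i" "prod p I"] coeff_mult_top[of "p i" "m i" "prod p I" "sum m I"] by force
qed simp_all

text \<open>The direction \<open>v\<close> is one on which the leading form of \<open>f\<close> does not vanish. The leading form is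
  taken from a representation of least degree, so that it is not the zero function.\<close>

lemma monic_direction:
  fixes f :: "('n::finite) cn_poly"
  assumes "f \<noteq> 0"
  shows "\<exists>v c F. c \<noteq> 0 \<and> lead_coeff F = 1 \<and> (\<forall>z t. poly (spec F z) t = c * peval f (z + t *s v))"
proof -
  define R where "R = (\<lambda>N S c. finite S \<and> (\<forall>\<alpha>\<in>S. sum \<alpha> UNIV \<le> N) \<and>
      peval f = (\<lambda>z. \<Sum>\<alpha>\<in>S. c \<alpha> * (\<Prod>i\<in>UNIV. (z $ i) ^ \<alpha> i)))"
  obtain S c where S: "finite S" "peval f = (\<lambda>z. \<Sum>\<alpha>\<in>S. c \<alpha> * (\<Prod>i\<in>UNIV. (z $ i) ^ \<alpha> i))"
    using polynomial_on_Cn_peval[of f] unfolding polynomial_on_Cn_def by blast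
  \<comment> \<open>A crude bound, which shows that a least one exists.\<close>
  then have "R (\<Sum>\<alpha>\<in>S. sum \<alpha> UNIV) S c"
    unfolding R_def by (auto intro: member_le_sum)
  then have ex: "\<exists>N. \<exists>S c. R N S c" by blast
  define N where "N = (LEAST N. \<exists>S c. R N S c)"
  obtain S c where "R N S c" unfolding N_def using LeastI_ex[OF ex] by blast
  then have S: "finite S" "\<And>\<alpha>. \<alpha> \<in> S \<Longrightarrow> sum \<alpha> UNIV \<le> N"
    and f: "\<And>z. peval f z = (\<Sum>\<alpha>\<in>S. c \<alpha> * (\<Prod>i\<in>UNIV. (z $ i) ^ \<alpha> i))"
    unfolding R_def by auto
  define T where "T = {\<alpha>\<in>S. sum \<alpha> UNIV = N}"
  define h where "h = (\<lambda>z :: complex ^ 'n. \<Sum>\<alpha>\<in>T. c \<alpha> * (\<Prod>i\<in>UNIV. (z $ i) ^ \<alpha> i))"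
  \<comment> \<open>If the leading form \<open>h\<close> vanished identically, the monomials in
    \<open>S - T\<close> would already represent \<open>f\<close> with the bound
    \<open>N - 1\<close>. The case \<open>N = 0\<close> is separate: then \<open>S - T\<close> is
    empty and \<open>f = 0\<close>.\<close>
  have "\<exists>v. h v \<noteq> 0"
  proof (rule ccontr)
    assume "\<not> ?thesis"
    then have "peval f z = (\<Sum>\<alpha>\<in>S - T. c \<alpha> * (\<Prod>i\<in>UNIV. (z $ i) ^ \<alpha> i))" for z
      using sum.subset_diff[of T S "\<lambda>\<alpha>. c \<alpha> * (\<Prod>i\<in>UNIV. (z $ i) ^ \<alpha> i)"] S(1)
      by (simp add: f h_def T_def)
    then have f': "peval f = (\<lambda>z. \<Sum>\<alpha>\<in>S - T. c \<alpha> * (\<Prod>i\<in>UNIV. (z $ i) ^ \<alpha> i))" by blast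
    have lt: "sum \<alpha> UNIV < N" if "\<alpha> \<in> S - T" for \<alpha>
      using that S(2)[of \<alpha>] by (auto simp: T_def le_less)
    have "N > 0"
    proof (rule ccontr)
      assume "\<not> N > 0"
      then have "S - T = {}" using lt by fastforce
      then have "peval f z = 0" for z unfolding f' by (simp only: sum.empty)
      then show False using assms cn_poly_eqI[of f 0] by simp
    qed
    have "R (N - 1) (S - T) c"
      unfolding R_def using S(1) lt f' by fastforce
    then have "N \<le> N - 1" unfolding N_def by (intro Least_le) blast
    then show False using \<open>N > 0\<close> by simp
  qed
  then obtain v where v: "h v \<noteq> 0" by blast
  define L where "L = (\<lambda>\<alpha>. \<Prod>i\<in>UNIV. [:Var i, Const (v $ i):] ^ \<alpha> i :: 'n cn_poly poly)"
  define F where "F = (\<Sum>\<alpha>\<in>S. smult (Const (c \<alpha>)) (L \<alpha>))"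
  have L: "degree (L \<alpha>) \<le> sum \<alpha> UNIV \<and> coeff (L \<alpha>) (sum \<alpha> UNIV) = (\<Prod>i\<in>UNIV. Const (v $ i) ^ \<alpha> i)" for \<alpha>
  proof -
    have "degree ([:Var i, Const (v $ i):] ^ \<alpha> i) \<le> \<alpha> i \<and>
        coeff ([:Var i, Const (v $ i):] ^ \<alpha> i) (\<alpha> i) = Const (v $ i) ^ \<alpha> i" for i
      using coeff_power_top[of "[:Var i, Const (v $ i):]" "\<alpha> i"] by simp
    then show ?thesis
      unfolding L_def using coeff_prod_top[of UNIV "\<lambda>i. [:Var i, Const (v $ i):] ^ \<alpha> i" \<alpha>] by simp
  qed
  have "degree F \<le> N"
    unfolding F_def using S L
    by (intro degree_sum_le) (auto intro: order.trans[OF degree_smult_le] order.trans)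
  \<comment> \<open>Only exponents in \<open>T\<close> reach degree \<open>N\<close>, and from each
    linear factor only the part \<open>t * v $ i\<close> contributes. So the top coefficient is the
    constant \<open>h v\<close> and can be divided out.\<close>
  have "coeff F N = (\<Sum>\<alpha>\<in>S. if \<alpha> \<in> T then Const (c \<alpha>) * (\<Prod>i\<in>UNIV. Const (v $ i) ^ \<alpha> i) else 0)"
  proof -
    have "coeff (L \<alpha>) N = 0" if "\<alpha> \<in> S" "\<alpha> \<notin> T" for \<alpha>
      using that L[of \<alpha>] S(2)[of \<alpha>] by (intro coeff_eq_0) (auto simp: T_def)
    then show ?thesis
      unfolding F_def coeff_sum using L by (intro sum.cong) (auto simp: T_def)
  qed
  also have "\<dots> = (\<Sum>\<alpha>\<in>T. Const (c \<alpha>) * (\<Prod>i\<in>UNIV. Const (v $ i) ^ \<alpha> i))"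
    using S(1) by (simp add: sum.If_cases T_def Int_def)
  also have "\<dots> = Const (h v)"
    by (rule cn_poly_eqI) (simp add: h_def)
  finally have cF: "coeff F N = Const (h v)" .
  then have "coeff F N \<noteq> 0" using v by simp
  then have degF: "degree F = N" using \<open>degree F \<le> N\<close> le_degree antisym by blast
  let ?c = "1 / h v"
  have "degree (smult (Const ?c) F) = N" using degF v by simp
  then have "lead_coeff (smult (Const ?c) F) = 1"
    using v by (auto simp: cF intro!: cn_poly_eqI)
  moreover have "poly (spec (smult (Const ?c) F) z) t = ?c * peval f (z + t *s v)" for z t
    by (simp add: poly_spec F_def L_def poly_sum poly_prod f)
  moreover have "?c \<noteq> 0" using v by simp
  ultimately show ?thesis by blast
qed

subsection \<open>Division\<close>

text \<open>The multiplier in pseudo-division is a power of the leading coefficient, here 1, so no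
  factor appears in front of \<open>F\<close>.\<close>

lemma monic_division:
  fixes F G :: "'a::idom poly"
  assumes "lead_coeff G = 1"
  shows "\<exists>Q R. F = G * Q + R \<and> (R = 0 \<or> degree R < degree G)"
proof -
  obtain Q R where QR: "pseudo_divmod F G = (Q, R)" by fastforce
  have "G \<noteq> 0" using assms by auto
  from pseudo_divmod[OF this QR] show ?thesis using assms by auto
qed

lemma pseudo_division:
  fixes F G :: "'a::idom poly"
  assumes "G \<noteq> 0"
  shows "\<exists>k Q R. smult (lead_coeff G ^ k) F = G * Q + R \<and> (R = 0 \<or> degree R < degree G)"
proof -
  obtain Q R where QR: "pseudo_divmod F G = (Q, R)" by fastforce
  from pseudo_divmod[OF assms this] show ?thesis by blast
qed

text \<open>At a root of \<open>Q\<close> the bound forces \<open>P\<close> to vanish too.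
  Cancelling the common linear factor keeps the bound, so induction on the degree of
  \<open>Q\<close> applies.\<close>

lemma locally_bounded_quotient_imp_poly_dvd:
  fixes P Q :: "complex poly"
  assumes "Q \<noteq> 0" "\<And>B. \<exists>C. \<forall>t. norm t \<le> B \<longrightarrow> norm (poly P t) \<le> C * norm (poly Q t)"
  shows "Q dvd P"
  using assms
proof (induction "degree Q" arbitrary: P Q)
  case 0
  then show ?case using is_unit_iff_degree[of Q] by (auto intro: unit_imp_dvd)
next
  case (Suc n)
  obtain a where a: "poly Q a = 0"
    using alg_closed_imp_poly_has_root[of Q] Suc.hyps(2) by auto
  have "poly P a = 0"
    using Suc.prems(2)[of "norm a"] a by fastforce
  then obtain P' Q' where P': "P = [:- a, 1:] * P'" and Q': "Q = [:- a, 1:] * Q'"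
    using a by (metis dvd_def poly_eq_0_iff_dvd)
  have "Q' \<noteq> 0" using Q' Suc.prems(1) by auto
  then have "degree Q' = n" using Suc.hyps(2) unfolding Q' by (subst (asm) degree_mult_eq) auto
  moreover have "\<exists>C. \<forall>t. norm t \<le> B \<longrightarrow> norm (poly P' t) \<le> C * norm (poly Q' t)" for B
  proof -
    \<comment> \<open>The radius is enlarged by 1 so that, for \<open>norm a \<le> B\<close>, the
      bound holds at all points near \<open>a\<close>; the bound at \<open>a\<close> itself then
      follows by a limit.\<close>
    obtain C where C: "\<And>t. norm t \<le> B + 1 \<Longrightarrow> norm (poly P t) \<le> C * norm (poly Q t)"
      using Suc.prems(2) by blast
    have ne: "norm (poly P' t) \<le> C * norm (poly Q' t)" if "norm t \<le> B + 1" "t \<noteq> a" for t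
    proof -
      have "norm (t - a) * norm (poly P' t) \<le> norm (t - a) * (C * norm (poly Q' t))"
        using C[OF that(1)] unfolding P' Q' poly_mult norm_mult by (simp add: mult_ac)
      then show ?thesis using that(2) by simp
    qed
    have "norm (poly P' a) \<le> C * norm (poly Q' a)" if "norm a \<le> B"
    proof -
      let ?g = "\<lambda>t. C * norm (poly Q' t) - norm (poly P' t)"
      have "(?g \<longlongrightarrow> ?g a) (at a)" by (intro tendsto_intros)
      moreover have "\<forall>\<^sub>F t in at a. 0 \<le> ?g t"
      proof -
        have "\<forall>\<^sub>F t in at a. dist t a < 1" using eventually_at_ball[of 1 a UNIV] by (simp add: dist_commute)
        moreover have "\<forall>\<^sub>F t in at a. t \<noteq> a" by (rule eventually_neq_at_within)
        ultimately show ?thesis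
        proof eventually_elim
          case (elim t)
          then have "norm t \<le> B + 1"
            using that norm_triangle_sub[of t a] by (simp add: dist_norm)
          then show ?case using ne elim by simp
        qed
      qed
      ultimately have "0 \<le> ?g a" by (rule tendsto_lowerbound) simp
      then show ?thesis by simp
    qed
    then have "\<forall>t. norm t \<le> B \<longrightarrow> norm (poly P' t) \<le> C * norm (poly Q' t)"
      using ne by (metis add_increasing2 zero_le_one)
    then show ?thesis by blast
  qed
  ultimately have "Q' dvd P'" using Suc.hyps(1) \<open>Q' \<noteq> 0\<close> by blast
  then show ?case unfolding P' Q' by (rule mult_dvd_mono[OF dvd_refl])
qed

lemma norm_vector_smult: "norm (c *s v :: complex ^ 'n::finite) = norm c * norm v"
  by (simp add: norm_vec_def L2_set_def norm_mult power_mult_distrib sum_distrib_left[symmetric]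
      real_sqrt_mult)

text \<open>Along a direction in which \<open>g\<close> is monic, \<open>f\<close> is divided with
  remainder \<open>R\<close>. On each line the one-variable result makes \<open>spec G z\<close>
  divide \<open>spec R z\<close>, and comparing degrees shows that \<open>R\<close> vanishes at
  every base point.\<close>

lemma locally_bounded_quotient_imp_dvd:
  fixes f g :: "('n::finite) cn_poly"
  assumes "g \<noteq> 0" "\<And>B. \<exists>C. \<forall>z. norm z \<le> B \<longrightarrow> norm (peval f z) \<le> C * norm (peval g z)"
  shows "g dvd f"
proof -
  obtain v c G where c: "c \<noteq> 0" and G: "lead_coeff G = 1"
    "\<And>z t. poly (spec G z) t = c * peval g (z + t *s v)"
    using monic_direction[OF assms(1)] by blast
  obtain F where F: "\<And>z t. poly (spec F z) t = peval f (z + t *s v)"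
    using line_expansion by metis
  obtain Q R where QR: "F = G * Q + R" "R = 0 \<or> degree R < degree G"
    using monic_division[OF G(1)] by blast
  have "spec R z = 0" for z
  proof (cases "R = 0")
    case False
    have deg: "degree (spec G z) = degree G" using G(1) by (intro degree_spec) simp
    have "\<exists>C. \<forall>t. norm t \<le> B \<longrightarrow> norm (poly (spec F z) t) \<le> C * norm (poly (spec G z) t)" for B
    proof -
      obtain C where C: "\<And>y. norm y \<le> norm z + B * norm v \<Longrightarrow> norm (peval f y) \<le> C * norm (peval g y)"
        using assms(2) by blast
      have "norm (poly (spec F z) t) \<le> C / norm c * norm (poly (spec G z) t)" if "norm t \<le> B" for t
      proof -
        have "norm (z + t *s v) \<le> norm z + B * norm v"
          using that norm_triangle_ineq[of z "t *s v"] mult_right_mono[OF that norm_ge_zero[of v]]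
          by (simp add: norm_vector_smult)
        from C[OF this] show ?thesis using c by (simp add: F G norm_mult)
      qed
      then show ?thesis by blast
    qed
    moreover have "spec G z \<noteq> 0"
      using G(1) coeff_spec[of G z "degree G"] by (metis coeff_0 peval_simps(2) zero_neq_one)
    ultimately have "spec G z dvd spec F z" by (intro locally_bounded_quotient_imp_poly_dvd)
    then have "spec G z dvd spec R z"
      using QR(1) by (simp add: dvd_add_right_iff)
    moreover have "degree (spec R z) < degree (spec G z)"
      using QR(2) False degree_spec_le[of R z] deg by linarith
    ultimately show ?thesis using dvd_imp_degree_le by fastforce
  qed simp
  then have "F = G * Q" using QR(1) spec_eqD[of R 0] by simp
  \<comment> \<open>The line parameter 0 turns the identity along lines into one in
    \<open>cn_poly\<close>.\<close>
  then have "peval f z = peval (g * (Const c * poly Q 0)) z" for z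
    using F[of z 0] G(2)[of z 0] by (simp add: poly_spec mult_ac)
  then have "f = g * (Const c * poly Q 0)" by (rule cn_poly_eqI)
  then show ?thesis by (rule dvdI)
qed

subsection \<open>Roots of monic polynomials\<close>

lemma norm_prod_mset_ge:
  fixes A :: "complex multiset"
  assumes "e \<ge> 0" "\<And>x. x \<in># A \<Longrightarrow> e \<le> norm x"
  shows "e ^ size A \<le> norm (\<Prod>x\<in>#A. - x)"
  using assms(2)
proof (induction A)
  case (add x A)
  then show ?case using assms(1) by (auto simp: norm_mult intro!: mult_mono)
qed simp

text \<open>Up to sign, the value at 0 is the product of the roots, whose modulus would be at least
  \<open>e ^ degree P\<close> if every root had modulus at least \<open>e\<close>.\<close>

lemma monic_small_root:
  fixes P :: "complex poly"
  assumes "lead_coeff P = 1" "e > 0" "norm (poly P 0) < e ^ degree P"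
  shows "\<exists>r. poly P r = 0 \<and> norm r < e"
proof (rule ccontr)
  assume none: "\<not> ?thesis"
  obtain A where A: "size A = degree P" "P = smult (lead_coeff P) (\<Prod>x\<in>#A. [:- x, 1:])"
    using alg_closed_imp_factorization[of P] assms(1) by (metis leading_coeff_0_iff zero_neq_one)
  then have eval: "poly P t = (\<Prod>x\<in>#A. t - x)" for t
    using assms(1) by (simp add: poly_prod_mset image_mset.compositionality o_def)
  have "e \<le> norm x" if "x \<in># A" for x
  proof -
    have "poly P x = 0" unfolding eval using that by (auto simp: prod_mset_zero_iff)
    then show ?thesis using none by force
  qed
  then have "e ^ size A \<le> norm (\<Prod>x\<in>#A. - x)"
    using assms(2) by (intro norm_prod_mset_ge) auto
  then show False using assms(3) A(1) by (simp add: eval)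
qed

text \<open>A further factor \<open>[:- x, 1:]\<close> shifts the coefficients and subtracts
  \<open>x\<close> times the old ones, so the bound grows by the factor
  \<open>1 + B\<close>.\<close>

lemma coeff_prod_mset_le:
  fixes A :: "complex multiset"
  assumes "B \<ge> 0" "\<And>x. x \<in># A \<Longrightarrow> norm x \<le> B"
  shows "norm (coeff (\<Prod>x\<in>#A. [:- x, 1:]) j) \<le> (1 + B) ^ size A"
  using assms(2)
proof (induction A arbitrary: j)
  case empty
  then show ?case by (simp add: coeff_pCons split: nat.split)
next
  case (add x A)
  let ?P = "\<Prod>x\<in>#A. [:- x, 1:]"
  have IH: "norm (coeff ?P i) \<le> (1 + B) ^ size A" for i using add by simp
  have "norm (coeff (pCons 0 ?P) j) \<le> (1 + B) ^ size A"
    using IH assms(1) by (cases j) auto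
  moreover have "norm (x * coeff ?P j) \<le> B * (1 + B) ^ size A"
    unfolding norm_mult using IH assms(1) add.prems by (intro mult_mono) auto
  moreover have "coeff (\<Prod>x\<in>#add_mset x A. [:- x, 1:]) j = coeff (pCons 0 ?P) j - x * coeff ?P j"
    by simp
  ultimately have "norm (coeff (\<Prod>x\<in>#add_mset x A. [:- x, 1:]) j) \<le>
      (1 + B) ^ size A + B * (1 + B) ^ size A"
    by (metis norm_triangle_le_diff add_mono)
  then show ?case by (simp add: algebra_simps)
qed

lemma monic_coeff_le:
  fixes P :: "complex poly"
  assumes "lead_coeff P = 1" "B \<ge> 0" "\<And>r. poly P r = 0 \<Longrightarrow> norm r \<le> B"
  shows "norm (coeff P j) \<le> (1 + B) ^ degree P"
proof -
  obtain A where A: "size A = degree P" "P = smult (lead_coeff P) (\<Prod>x\<in>#A. [:- x, 1:])"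
    using alg_closed_imp_factorization[of P] assms(1) by (metis leading_coeff_0_iff zero_neq_one)
  then have P: "P = (\<Prod>x\<in>#A. [:- x, 1:])" using assms(1) by simp
  have "poly P x = 0" if "x \<in># A" for x
    unfolding P using that by (auto simp: poly_prod_mset prod_mset_zero_iff)
  then have "norm (coeff (\<Prod>x\<in>#A. [:- x, 1:]) j) \<le> (1 + B) ^ size A"
    using assms by (intro coeff_prod_mset_le) auto
  then show ?thesis using A(1) P by simp
qed

text \<open>A Cauchy-type root bound: for \<open>norm r > 1\<close>, solve for the top power and
  divide by \<open>norm r ^ (degree P - 1)\<close>. The summand 1 covers the roots in the unit
  disc.\<close>

lemma monic_root_le:
  fixes P :: "complex poly"
  assumes "lead_coeff P = 1" "poly P r = 0"
  shows "norm r \<le> 1 + (\<Sum>i<degree P. norm (coeff P i))"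
proof (cases "norm r \<le> 1")
  case True
  then show ?thesis using sum_nonneg[of "{..<degree P}" "\<lambda>i. norm (coeff P i)"] by simp
next
  case False
  have "degree P \<noteq> 0"
  proof
    assume "degree P = 0"
    then obtain c where "P = [:c:]" by (rule degree_eq_zeroE)
    then show False using assms by simp
  qed
  then obtain n where n: "degree P = Suc n" using not0_implies_Suc by blast
  have "0 = (\<Sum>i<Suc n. coeff P i * r ^ i) + r ^ Suc n"
    using assms n by (simp add: poly_altdef lessThan_Suc_atMost[symmetric] del: power_Suc)
  then have "r ^ Suc n = - (\<Sum>i<Suc n. coeff P i * r ^ i)"
    unfolding eq_neg_iff_add_eq_0 by (simp only: add.commute)
  then have "norm (r ^ Suc n) = norm (\<Sum>i<Suc n. coeff P i * r ^ i)" by (metis norm_minus_cancel)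
  also have "\<dots> \<le> (\<Sum>i<Suc n. norm (coeff P i) * norm r ^ n)"
  proof (intro sum_norm_le)
    fix i assume "i \<in> {..<Suc n}"
    then have "norm r ^ i \<le> norm r ^ n" using False by (intro power_increasing) auto
    then show "norm (coeff P i * r ^ i) \<le> norm (coeff P i) * norm r ^ n"
      by (simp add: norm_mult norm_power mult_left_mono)
  qed
  also have "\<dots> = (\<Sum>i<Suc n. norm (coeff P i)) * norm r ^ n" by (rule sum_distrib_right[symmetric])
  finally have "norm r * norm r ^ n \<le> (\<Sum>i<Suc n. norm (coeff P i)) * norm r ^ n"
    by (simp add: norm_power norm_mult)
  moreover have "norm r ^ n > 0" using False by (intro zero_less_power) linarith
  ultimately have "norm r \<le> (\<Sum>i<Suc n. norm (coeff P i))" by (rule mult_right_le_imp_le)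
  then show ?thesis using n by simp
qed

subsection \<open>Reduced fractions\<close>

text \<open>At points where the leading coefficient of \<open>U\<close> does not vanish, the roots of \<open>U\<close> are roots of the
  monic \<open>Q\<close>, hence locally bounded; so the quotients of the coefficients of \<open>U\<close> by the leading one are
  locally bounded.\<close>

lemma lead_coeff_factor:
  fixes Q U m :: "('n::finite) cn_poly poly"
  assumes Q: "lead_coeff Q = 1" and U: "U \<noteq> 0"
    and Um: "smult (lead_coeff U ^ k) Q = U * m"
  shows "\<exists>V. U = smult (lead_coeff U) V"
proof -
  define a where "a = lead_coeff U"
  have a: "a \<noteq> 0" using U by (simp add: a_def)
  have "a dvd coeff U j" for j
  proof (rule locally_bounded_quotient_imp_dvd[OF a])
    fix B :: real
    \<comment> \<open>\<open>?g z\<close> is the root bound for the monic \<open>spec Q z\<close>;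
      compactness makes it uniform for \<open>z\<close> in a ball.\<close>
    let ?g = "\<lambda>z. 1 + (\<Sum>i<degree Q. norm (peval (coeff Q i) z))"
    have "compact (?g ` cball 0 (B + 1))"
      by (intro compact_continuous_image continuous_intros continuous_on_peval compact_cball)
    then have "bdd_above (?g ` cball 0 (B + 1))"
      by (intro bounded_imp_bdd_above compact_imp_bounded)
    then obtain M where M: "\<And>z. norm z \<le> B + 1 \<Longrightarrow> ?g z \<le> M"
      unfolding bdd_above_def by force
    define C where "C = (1 + \<bar>M\<bar>) ^ degree U"
    have generic: "norm (peval (coeff U j) z) \<le> C * norm (peval a z)"
      if "norm z \<le> B + 1" "peval a z \<noteq> 0" for z
    proof -
      define P where "P = smult (1 / peval a z) (spec U z)"
      have degU: "degree (spec U z) = degree U"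
        using that(2) unfolding a_def by (rule degree_spec)
      then have degP: "degree P = degree U" using that(2) by (simp add: P_def)
      have "lead_coeff P = 1" using degU that(2) by (simp add: P_def a_def)
      moreover have "norm r \<le> \<bar>M\<bar>" if r: "poly P r = 0" for r
      proof -
        have "poly (spec U z) r = 0" using r \<open>peval a z \<noteq> 0\<close> by (simp add: P_def)
        then have "poly (spec (smult (a ^ k) Q) z) r = 0" unfolding a_def Um by simp
        then have "poly (spec Q z) r = 0" using \<open>peval a z \<noteq> 0\<close> by simp
        moreover have "degree (spec Q z) = degree Q" using Q by (intro degree_spec) simp
        ultimately have "norm r \<le> ?g z"
          using monic_root_le[of "spec Q z" r] Q by simp
        then show ?thesis using M[OF \<open>norm z \<le> B + 1\<close>] by linarith
      qed
      ultimately have "norm (coeff P j) \<le> (1 + \<bar>M\<bar>) ^ degree P" by (intro monic_coeff_le) auto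
      then show ?thesis
        using that(2) unfolding degP C_def[symmetric] by (simp add: P_def norm_divide field_simps)
    qed
    \<comment> \<open>This includes the zeros of \<open>a\<close>: a violation at \<open>z\<close>
      would persist on an open set, which contains a point with \<open>a\<close> nonzero where the
      bound is known. The radius \<open>B + 1\<close> leaves room for this.\<close>
    have "norm (peval (coeff U j) z) \<le> C * norm (peval a z)" if "norm z \<le> B" for z
    proof (rule ccontr)
      assume neg: "\<not> ?thesis"
      define W where "W = {y. C * norm (peval a y) < norm (peval (coeff U j) y)} \<inter> ball 0 (B + 1)"
      have "open W"
        unfolding W_def by (intro open_Int open_ball open_Collect_less continuous_intros continuous_on_peval)
      moreover have "z \<in> W" using neg that by (simp add: W_def)
      ultimately obtain y where "y \<in> W" "peval a y \<noteq> 0" using peval_nonzero_dense[OF a] by blast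
      then show False using generic[of y] by (simp add: W_def)
    qed
    then show "\<exists>C. \<forall>z. norm z \<le> B \<longrightarrow> norm (peval (coeff U j) z) \<le> C * norm (peval a z)" by blast
  qed
  then have "[:a:] dvd U" by (simp add: const_poly_dvd_iff)
  then show ?thesis unfolding a_def by (auto simp: dvd_def)
qed

lemma tendsto_line:
  "((\<lambda>s. z + s *s v :: complex ^ 'n::finite) \<longlongrightarrow> z + t *s v) (at t)"
  by (intro vec_tendstoI) (simp, intro tendsto_intros)

text \<open>The fraction in lowest terms: \<open>q\<^sub>0\<close> has least degree (along a direction in which \<open>q\<close> is monic)
  among the denominators of \<open>p / q\<close>. Minimality yields a Bezout identity
  \<open>\<alpha> p\<^sub>0 + \<beta> q\<^sub>0 = r\<close> with \<open>r \<noteq> 0\<close> constant along that direction. If \<open>p / q\<close> is holomorphic near a zero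
  \<open>x\<close> of \<open>q\<^sub>0\<close>, then every line near \<open>x\<close> carries a common zero of \<open>p\<^sub>0\<close> and \<open>q\<^sub>0\<close>, so \<open>r\<close> vanishes on an
  open set.\<close>

lemma reduced_fraction:
  fixes p q :: "('n::finite) cn_poly"
  assumes "q \<noteq> 0"
  shows "\<exists>p0 q0. q0 * p = p0 * q \<and>
    (\<forall>x w. quotient_has_value (peval p) (peval q) x w \<longrightarrow> peval q0 x \<noteq> 0)"
proof -
  obtain v c Q where c: "c \<noteq> 0" and Q: "lead_coeff Q = 1"
    and evQ: "\<And>z t. poly (spec Q z) t = c * peval q (z + t *s v)"
    using monic_direction[OF assms] by blast
  obtain P1 where P1: "\<And>z t. poly (spec P1 z) t = peval p (z + t *s v)"
    using line_expansion by metis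
  define P where "P = smult (Const c) P1"
  have evP: "poly (spec P z) t = c * peval p (z + t *s v)" for z t by (simp add: P_def P1)
  have Q0: "Q \<noteq> 0" using Q by auto

  \<comment> \<open>\<open>I\<close> holds for the nonzero denominators of the fraction
    \<open>P / Q\<close>.\<close>
  define I where "I = (\<lambda>U. U \<noteq> 0 \<and> (\<exists>V. U * P = V * Q))"
  have "I Q" unfolding I_def using Q0 by (metis mult.commute)
  then obtain U where U: "I U" and Umin: "\<And>U'. I U' \<Longrightarrow> degree U \<le> degree U'"
    using ex_has_least_nat[of I Q degree] by blast
  obtain V where V: "U * P = V * Q" and "U \<noteq> 0" using U unfolding I_def by blast
  define a where "a = lead_coeff U"
  have a: "a \<noteq> 0" using \<open>U \<noteq> 0\<close> by (simp add: a_def)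
  obtain k m R where R: "smult (a ^ k) Q = U * m + R" "R = 0 \<or> degree R < degree U"
    using pseudo_division[OF \<open>U \<noteq> 0\<close>] unfolding a_def by blast
  \<comment> \<open>If nonzero, \<open>R\<close> would be a denominator of smaller degree than
    \<open>U\<close>. Hence \<open>U\<close> divides \<open>a ^ k\<close> times the monic
    \<open>Q\<close>, as \<open>lead_coeff_factor\<close> requires.\<close>
  have "R * P = (smult (a ^ k) P - m * V) * Q"
  proof -
    have "R * P = smult (a ^ k) Q * P - m * (U * P)" unfolding R(1) by (simp add: algebra_simps)
    also have "\<dots> = (smult (a ^ k) P - m * V) * Q" unfolding V by (simp add: algebra_simps)
    finally show ?thesis .
  qed
  then have "R = 0" using Umin[of R] R(2) unfolding I_def by force
  then obtain q0 where q0: "U = smult a q0"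
    using lead_coeff_factor[OF Q \<open>U \<noteq> 0\<close>] R(1) unfolding a_def by auto
  have degq0: "degree q0 = degree U" using a unfolding q0 by simp
  have "a * lead_coeff q0 = a * 1" using degq0 q0 a_def by (metis coeff_smult mult.right_neutral)
  then have lq0: "lead_coeff q0 = 1" using a mult_left_cancel by blast
  have "q0 \<noteq> 0" using lq0 by auto
  obtain p0 R' where R': "q0 * P = Q * p0 + R'" "R' = 0 \<or> degree R' < degree Q"
    using monic_division[OF Q] by blast
  have "R' = 0"
  proof (rule ccontr)
    assume "R' \<noteq> 0"
    \<comment> \<open>Since \<open>smult a q0\<close> is a denominator with numerator
      \<open>V\<close>, scaling by \<open>a\<close> turns the remainder into a multiple of
      \<open>Q\<close>, which its degree rules out.\<close>
    have eq: "smult a R' = (V - smult a p0) * Q"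
    proof -
      have "smult a R' = smult a q0 * P - smult a p0 * Q"
        using arg_cong[OF R'(1), of "smult a"] by (simp add: smult_add_right mult_ac)
      also have "\<dots> = (V - smult a p0) * Q" using V q0 by (simp add: algebra_simps)
      finally show ?thesis .
    qed
    moreover have "smult a R' \<noteq> 0" using a \<open>R' \<noteq> 0\<close> by simp
    ultimately have "degree (smult a R') = degree (V - smult a p0) + degree Q"
      using degree_mult_eq[of "V - smult a p0" Q] by force
    then show False using R'(2) \<open>R' \<noteq> 0\<close> a by simp
  qed
  then have pq: "q0 * P = Q * p0" using R'(1) by simp

  \<comment> \<open>\<open>J\<close> holds for the nonzero members of the ideal generated by
    \<open>p0\<close> and \<open>q0\<close>. A member \<open>W\<close> of least degree divides all
    of them up to powers of its leading coefficient \<open>b\<close>.\<close>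
  define J where "J = (\<lambda>W. W \<noteq> 0 \<and> (\<exists>\<alpha> \<beta>. W = \<alpha> * p0 + \<beta> * q0))"
  have "J q0" unfolding J_def using \<open>q0 \<noteq> 0\<close> by (intro conjI exI[of _ 0] exI[of _ 1]) auto
  then obtain W where W: "J W" and Wmin: "\<And>W'. J W' \<Longrightarrow> degree W \<le> degree W'"
    using ex_has_least_nat[of J q0 degree] by blast
  obtain \<alpha> \<beta> where bezout: "W = \<alpha> * p0 + \<beta> * q0" and "W \<noteq> 0" using W unfolding J_def by blast
  define b where "b = lead_coeff W"
  have b: "b \<noteq> 0" using \<open>W \<noteq> 0\<close> by (simp add: b_def)
  have divides: "\<exists>s M. smult (b ^ s) (\<gamma> * p0 + \<delta> * q0) = W * M" for \<gamma> \<delta>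
  proof -
    let ?X = "\<gamma> * p0 + \<delta> * q0"
    obtain s M R where R: "smult (b ^ s) ?X = W * M + R" "R = 0 \<or> degree R < degree W"
      using pseudo_division[OF \<open>W \<noteq> 0\<close>] unfolding b_def by blast
    have "R = smult (b ^ s) ?X - W * M" unfolding R(1) by simp
    also have "\<dots> = (smult (b ^ s) \<gamma> - M * \<alpha>) * p0 + (smult (b ^ s) \<delta> - M * \<beta>) * q0"
      unfolding bezout by (simp add: algebra_simps smult_add_right)
    finally have "R = 0" using Wmin[of R] R(2) unfolding J_def by force
    then show ?thesis using R(1) by auto
  qed
  obtain s1 M1 where M1: "smult (b ^ s1) q0 = W * M1" using divides[of 0 1] by auto
  obtain s2 M2 where M2: "smult (b ^ s2) p0 = W * M2" using divides[of 1 0] by auto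
  \<comment> \<open>Cancelling \<open>W\<close> makes \<open>M1\<close>, up to a power of
    \<open>b\<close>, a denominator of \<open>P / Q\<close> of degree
    \<open>degree q0 - degree W\<close>. Minimality of \<open>U\<close> then gives
    \<open>degree W = 0\<close>.\<close>
  have "W * (smult (b ^ s2) M1 * P) = smult (b ^ s2) (W * M1) * P" by (simp add: mult_ac)
  also have "\<dots> = smult (b ^ s2) (smult (b ^ s1) (q0 * P))" unfolding M1[symmetric] by simp
  also have "\<dots> = smult (b ^ s1) (smult (b ^ s2) p0) * Q" unfolding pq by (simp add: mult_ac)
  also have "\<dots> = W * (smult (b ^ s1) M2 * Q)" unfolding M2 by (simp add: mult_ac)
  finally have "smult (b ^ s2) M1 * P = smult (b ^ s1) M2 * Q"
    using mult_left_cancel[OF \<open>W \<noteq> 0\<close>] by blast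
  moreover have "M1 \<noteq> 0" using M1 b \<open>q0 \<noteq> 0\<close> by auto
  ultimately have "I (smult (b ^ s2) M1)" unfolding I_def using b
    by (intro conjI exI[of _ "smult (b ^ s1) M2"]) simp_all
  then have "degree U \<le> degree M1" using Umin b by force
  moreover have "degree q0 = degree W + degree M1"
    using arg_cong[OF M1, of degree] degree_mult_eq[OF \<open>W \<noteq> 0\<close> \<open>M1 \<noteq> 0\<close>] b by simp
  ultimately have "degree W = 0" using degq0 by simp
  then obtain r where r: "W = [:r:]" by (rule degree_eq_zeroE)
  then have "r \<noteq> 0" using \<open>W \<noteq> 0\<close> by simp

  have "peval (poly q0 0) x \<noteq> 0" if val: "quotient_has_value (peval p) (peval q) x w" for x w
  proof
    assume zero: "peval (poly q0 0) x = 0"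
    obtain X h where X: "open X" "x \<in> X" "holomorphic_on_Cn h X"
      "\<And>y. y \<in> X \<Longrightarrow> peval q y \<noteq> 0 \<Longrightarrow> h y = peval p y / peval q y"
      using val unfolding quotient_has_value_def by blast
    obtain d where d: "d > 0" "ball x d \<subseteq> X" using X open_contains_ball by blast
    \<comment> \<open>Parameters below \<open>e\<close> in modulus move a point by at most
      \<open>d / 2\<close>, so starting within \<open>d / 2\<close> of \<open>x\<close> one stays in
      \<open>ball x d\<close>. The summand 1 allows for \<open>v = 0\<close>.\<close>
    define e where "e = d / (2 * (norm v + 1))"
    have e: "e > 0" "e * norm v \<le> d / 2"
      using d(1) by (auto simp: e_def field_simps add_pos_nonneg)
    \<comment> \<open>The condition on \<open>q0\<close> is the one of
      \<open>monic_small_root\<close>: the line through any \<open>z\<close> in \<open>N\<close>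
      meets a zero of \<open>q0\<close> at a parameter below \<open>e\<close>.\<close>
    define N where "N = {z. norm (peval (poly q0 0) z) < e ^ degree q0} \<inter> ball x (d / 2)"
    have "open N"
      unfolding N_def by (intro open_Int open_ball open_Collect_less continuous_intros continuous_on_peval)
    moreover have "x \<in> N" using zero e d(1) by (simp add: N_def)
    ultimately obtain z where z: "z \<in> N" "peval r z \<noteq> 0" using peval_nonzero_dense[OF \<open>r \<noteq> 0\<close>] by blast
    have "degree (spec q0 z) = degree q0" using lq0 by (intro degree_spec) simp
    then obtain t where t: "poly (spec q0 z) t = 0" "norm t < e"
      using monic_small_root[of "spec q0 z" e] lq0 e(1) z(1) by (auto simp: poly_spec N_def)
    have "norm (t *s v) \<le> d / 2"
      using mult_right_mono[OF less_imp_le[OF t(2)] norm_ge_zero[of v]] e(2)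
      by (simp add: norm_vector_smult)
    then have inX: "z + t *s v \<in> X"
      using z(1) d(2) norm_triangle_ineq4[of "x - z" "t *s v"]
      by (auto simp: N_def dist_norm subset_iff algebra_simps)
    \<comment> \<open>Off the finitely many zeros of \<open>q\<close> on the line this follows from
      \<open>q0 * P = Q * p0\<close>; it reaches \<open>t\<close>, where \<open>q\<close> may
      vanish, by continuity.\<close>
    have "poly (spec p0 z) t = h (z + t *s v) * poly (spec q0 z) t"
    proof (rule tendsto_unique[OF trivial_limit_at])
      show "(poly (spec p0 z) \<longlongrightarrow> poly (spec p0 z) t) (at t)" by (intro tendsto_intros)
      have "isCont h (z + t *s v)"
        using holomorphic_on_Cn_continuous_on[OF X(3)] X(1) inX continuous_on_eq_continuous_at by blast
      then have "((\<lambda>s. h (z + s *s v) * poly (spec q0 z) s) \<longlongrightarrow> h (z + t *s v) * poly (spec q0 z) t) (at t)"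
        by (intro tendsto_mult isCont_tendsto_compose[OF _ tendsto_line]) (auto intro!: tendsto_intros)
      moreover have "\<forall>\<^sub>F s in at t. h (z + s *s v) * poly (spec q0 z) s = poly (spec p0 z) s"
      proof -
        have "\<forall>\<^sub>F s in at t. z + s *s v \<in> X" using tendsto_line X(1) inX by (rule topological_tendstoD)
        moreover have "spec Q z \<noteq> 0"
          using Q coeff_spec[of Q z "degree Q"] by (metis coeff_0 peval_simps(2) zero_neq_one)
        then have "finite {s. poly (spec Q z) s = 0}" by (rule poly_roots_finite)
        then have "\<forall>\<^sub>F s in at t. poly (spec Q z) s \<noteq> 0"
          using islimpt_finite[of "{s. poly (spec Q z) s = 0}" t] by (simp add: islimpt_iff_eventually)
        ultimately show ?thesis
        proof eventually_elim
          case (elim s)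
          have "poly (spec (q0 * P) z) s = poly (spec (Q * p0) z) s" by (simp only: pq)
          then have "poly (spec q0 z) s * peval p (z + s *s v) = peval q (z + s *s v) * poly (spec p0 z) s"
            using c by (simp add: evP evQ)
          moreover have ne: "peval q (z + s *s v) \<noteq> 0" using elim(2) by (simp add: evQ)
          ultimately show ?case
            unfolding X(4)[OF elim(1) ne] by (simp add: field_simps)
        qed
      qed
      ultimately show "(poly (spec p0 z) \<longlongrightarrow> h (z + t *s v) * poly (spec q0 z) t) (at t)"
        by (rule Lim_transform_eventually)
    qed
    then have "poly (spec W z) t = 0" using t(1) by (simp add: bezout)
    then show False using z(2) by (simp add: r)
  qed
  moreover have "poly q0 0 * p = poly p0 0 * q"
  proof (rule cn_poly_eqI)
    fix z
    have "poly (spec (q0 * P) z) 0 = poly (spec (Q * p0) z) 0" by (simp only: pq)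
    then have "c * (peval (poly q0 0) z * peval p z) = c * (peval q z * peval (poly p0 0) z)"
      using evP[of z 0] evQ[of z 0] by (simp add: poly_spec)
    then show "peval (poly q0 0 * p) z = peval (poly p0 0 * q) z"
      using c by (simp add: mult_ac)
  qed
  ultimately show ?thesis by blast
qed

subsection \<open>The rationally convex hull\<close>

lemma quotient_has_value_reduced:
  assumes "q0 * p = p0 * q" "peval q0 x \<noteq> 0"
  shows "quotient_has_value (peval p) (peval q) x (peval p0 x / peval q0 x)"
proof -
  let ?U = "{y. peval q0 y \<noteq> 0}"
  have "open ?U" by (intro open_Collect_neq continuous_on_peval continuous_on_const)
  moreover have "holomorphic_on_Cn (\<lambda>y. peval p0 y / peval q0 y) ?U"
    by (intro holomorphic_on_Cn_divide holomorphic_on_Cn_polynomial polynomial_on_Cn_peval) simp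
  moreover have "peval p0 y / peval q0 y = peval p y / peval q y"
    if "peval q0 y \<noteq> 0" "peval q y \<noteq> 0" for y
  proof -
    have "peval (q0 * p) y = peval (p0 * q) y" by (simp only: assms(1))
    then show ?thesis using that by (simp add: field_simps)
  qed
  ultimately show ?thesis
    unfolding quotient_has_value_def using assms(2)
    by (intro exI[of _ ?U] exI[of _ "\<lambda>y. peval p0 y / peval q0 y"]) auto
qed

text \<open>An extension \<open>h\<close> would satisfy \<open>h * f = 1\<close> on the dense set of
  nonzeros of \<open>f\<close>, hence by continuity also at \<open>x\<close>.\<close>

lemma not_quotient_has_value_inverse:
  assumes "f \<noteq> 0" "peval f x = 0"
  shows "\<not> quotient_has_value (\<lambda>_. 1) (peval f) x w"
proof
  assume "quotient_has_value (\<lambda>_. 1) (peval f) x w"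
  then obtain U h where U: "open U" "x \<in> U" "holomorphic_on_Cn h U"
    "\<And>y. y \<in> U \<Longrightarrow> peval f y \<noteq> 0 \<Longrightarrow> h y = 1 / peval f y"
    unfolding quotient_has_value_def by blast
  have "continuous_on U (\<lambda>y. h y * peval f y)"
    by (intro continuous_intros holomorphic_on_Cn_continuous_on[OF U(3)] continuous_on_peval)
  then have "open (U \<inter> (\<lambda>y. h y * peval f y) -` (- {1}))"
    using U(1) by (intro continuous_open_preimage) auto
  moreover have "x \<in> U \<inter> (\<lambda>y. h y * peval f y) -` (- {1})" using U(2) assms(2) by simp
  ultimately obtain y where "y \<in> U \<inter> (\<lambda>y. h y * peval f y) -` (- {1})" "peval f y \<noteq> 0"
    using peval_nonzero_dense[OF assms(1)] by blast
  then show False using U(4)[of y] by simp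
qed

lemma rational_hull_polynomial:
  assumes z: "z \<in> rational_hull Q" and "Q \<noteq> {}"
  shows "\<exists>x\<in>Q. peval f x = peval f z"
proof (rule ccontr)
  assume none: "\<not> ?thesis"
  define g where "g = f - Const (peval f z)"
  have gQ: "peval g x \<noteq> 0" if "x \<in> Q" for x using none that by (auto simp: g_def)
  \<comment> \<open>A point of \<open>Q\<close> witnesses that \<open>g\<close> is not the zero
    function, so \<open>1 / g\<close> is a rational function.\<close>
  have "g \<noteq> 0" using gQ \<open>Q \<noteq> {}\<close> by force
  then have "peval g \<noteq> (\<lambda>z. 0)" using cn_poly_eqI[of g 0] by auto
  then obtain r where r: "r \<in> rational_functions"
    "\<And>x w. r x = Some w \<longleftrightarrow> quotient_has_value (\<lambda>_. 1) (peval g) x w"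
    using rational_function_exists[OF polynomial_on_Cn_const polynomial_on_Cn_peval, of g 1] by blast
  have one: "peval 1 = (\<lambda>_. 1)" by auto
  have "x \<in> dom r" if "x \<in> Q" for x
    using quotient_has_value_reduced[of g 1 1 g x] gQ[OF that] by (auto simp: r(2) one dom_def)
  then have "r \<in> rational_functions_over Q" using r(1) by (auto simp: rational_functions_over_def)
  then have "z \<in> dom r" using z by (simp add: rational_hull_def)
  moreover have "peval g z = 0" by (simp add: g_def)
  ultimately show False using r(2) not_quotient_has_value_inverse[OF \<open>g \<noteq> 0\<close>] by auto
qed

lemma polynomial_imp_rational_hull:
  assumes "compact Q" and z: "\<And>f. \<exists>x\<in>Q. peval f x = peval f z"
  shows "z \<in> rational_hull Q"
  unfolding rational_hull_def
proof (intro CollectI ballI)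
  fix r assume "r \<in> rational_functions_over Q"
  then have "r \<in> rational_functions" and dom: "Q \<subseteq> dom r"
    unfolding rational_functions_over_def by auto
  from this(1) obtain p q where q: "polynomial_on_Cn p" "polynomial_on_Cn q" "q \<noteq> (\<lambda>z. 0)"
    and r: "\<And>x w. r x = Some w \<longleftrightarrow> quotient_has_value p q x w"
    unfolding rational_functions_def by (elim CollectE exE conjE) simp
  have "cn_poly q \<noteq> 0"
  proof
    assume "cn_poly q = 0"
    then have "q z = peval 0 z" for z using peval_cn_poly[OF q(2)] by simp
    then show False using q(3) by auto
  qed
  then obtain p0 q0 where p0: "q0 * cn_poly p = p0 * cn_poly q"
    and q0: "\<And>x w. quotient_has_value p q x w \<Longrightarrow> peval q0 x \<noteq> 0"
    using reduced_fraction[of "cn_poly q" "cn_poly p"] by (auto simp: peval_cn_poly q)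
  have rval: "r x = Some (peval p0 x / peval q0 x)" if "peval q0 x \<noteq> 0" for x
    using quotient_has_value_reduced[OF p0 that] by (simp add: r peval_cn_poly q)
  have q0Q: "peval q0 x \<noteq> 0" if "x \<in> Q" for x using dom q0 that r by blast
  then have q0z: "peval q0 z \<noteq> 0" using z[of q0] by auto
  \<comment> \<open>With \<open>w\<close> the value of \<open>r\<close> at \<open>z\<close>, the
    polynomial \<open>p0 - w q0\<close> vanishes at \<open>z\<close>. A zero of it in
    \<open>Q\<close> is a point where \<open>r\<close> again takes the value
    \<open>w\<close>.\<close>
  obtain x where x: "x \<in> Q" "peval (p0 - Const (peval p0 z / peval q0 z) * q0) x = 0"
    using z[of "p0 - Const (peval p0 z / peval q0 z) * q0"] q0z by auto
  then have eq: "the (r z) = the (r x)"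
    using rval[OF q0z] rval[OF q0Q[OF x(1)]] q0Q[OF x(1)] by (simp add: field_simps)
  \<comment> \<open>Continuity on the compact \<open>Q\<close> gives the boundedness that makes the
    real supremum an upper bound.\<close>
  have "continuous_on Q (\<lambda>x. norm (peval p0 x / peval q0 x))"
    using q0Q by (intro continuous_intros continuous_on_peval) auto
  then have "continuous_on Q (\<lambda>x. norm (the (r x)))"
    using rval q0Q by (elim continuous_on_eq) simp
  then have "bdd_above ((\<lambda>x. norm (the (r x))) ` Q)"
    using assms(1) by (intro bounded_imp_bdd_above compact_imp_bounded compact_continuous_image)
  then have "norm (the (r z)) \<le> (SUP x\<in>Q. norm (the (r x)))"
    unfolding eq using x(1) by (rule cSUP_upper[rotated])
  then show "z \<in> dom r \<and> norm (the (r z)) \<le> (SUP x\<in>Q. norm (the (r x)))"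
    using rval[OF q0z] by auto
qed

lemma norm_le_of_components:
  fixes z :: "complex ^ 'n::finite"
  assumes "\<And>i. norm (z $ i) \<le> B"
  shows "norm z \<le> real CARD('n) * B"
proof -
  have "norm z \<le> (\<Sum>i\<in>UNIV. norm (z $ i))"
    unfolding norm_vec_def by (rule L2_set_le_sum) simp
  also have "\<dots> \<le> (\<Sum>i\<in>(UNIV :: 'n set). B)" using assms by (rule sum_mono)
  finally show ?thesis by simp
qed

lemma rational_hull_nonempty_compact:
  fixes Q :: "(complex ^ 'n::finite) set"
  assumes "Q \<in> nonempty_compacts"
  shows "rational_hull Q \<in> nonempty_compacts"
proof -
  have Q: "compact Q" "Q \<noteq> {}" using assms by (auto simp: nonempty_compacts_def)
  have "rational_hull Q = (\<Inter>f. peval f -` (peval f ` Q))"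
  proof (intro set_eqI iffI)
    fix z assume "z \<in> rational_hull Q"
    from rational_hull_polynomial[OF this Q(2)] show "z \<in> (\<Inter>f. peval f -` (peval f ` Q))"
      by (auto simp: image_iff) metis
  next
    fix z assume "z \<in> (\<Inter>f. peval f -` (peval f ` Q))"
    then have "peval f z \<in> peval f ` Q" for f by auto
    then show "z \<in> rational_hull Q"
      by (intro polynomial_imp_rational_hull[OF Q(1)]) (metis imageE)
  qed
  moreover have "closed (peval f -` (peval f ` Q))" for f
    by (intro closed_vimage compact_imp_closed compact_continuous_image continuous_on_peval Q)
  ultimately have "closed (rational_hull Q)" by auto
  moreover have "bounded (rational_hull Q)"
  proof -
    obtain B where B: "\<And>x. x \<in> Q \<Longrightarrow> norm x \<le> B"
      using compact_imp_bounded[OF Q(1)] by (auto simp: bounded_iff)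
    have "norm z \<le> real CARD('n) * B" if zh: "z \<in> rational_hull Q" for z
    proof (rule norm_le_of_components)
      fix i
      obtain x where "x \<in> Q" "x $ i = z $ i"
        using rational_hull_polynomial[OF zh Q(2), of "Var i"] by auto
      then show "norm (z $ i) \<le> B" using B[of x] Finite_Cartesian_Product.norm_nth_le[of x i] by simp
    qed
    then show ?thesis by (auto simp: bounded_iff)
  qed
  moreover have "Q \<subseteq> rational_hull Q"
    by (intro subsetI polynomial_imp_rational_hull[OF Q(1)]) auto
  ultimately show ?thesis
    using Q(2) by (auto simp: nonempty_compacts_def compact_eq_bounded_closed)
qed

section \<open>Upper semicontinuity of the hull\<close>

lemma exists_close_point:
  assumes "A \<in> nonempty_compacts" "B \<in> nonempty_compacts" "x \<in> A" "hausdorff_dist A B < e"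
  shows "\<exists>y\<in>B. dist x y < e"
proof -
  have "infdist x B < e" using infdist_le_hausdorff_dist[OF assms(1-3)] assms(4) by simp
  moreover have "B \<noteq> {}" using assms(2) by (simp add: nonempty_compacts_def)
  ultimately show ?thesis
    using cInf_lessD[of "dist x ` B" e] by (simp add: infdist_def)
qed

text \<open>Upper semicontinuity of the hull: limits of points of \<open>rational_hull (A n)\<close> lie in
  \<open>rational_hull Q\<close> if \<open>A n\<close> tends to \<open>Q\<close>, because the condition \<open>f z \<in> f ` A n\<close> passes to the limit.\<close>

lemma openin_rational_hull_disjoint:
  fixes C :: "(complex ^ 'n::finite) set"
  assumes "closed C"
  shows "openin (Metric_space.mtopology nonempty_compacts hausdorff_dist)
    {Q \<in> nonempty_compacts. rational_hull Q \<inter> C = {}}"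
proof -
  interpret Metric_space "nonempty_compacts :: (complex ^ 'n) set set" hausdorff_dist
    by (rule Metric_space_hausdorff_dist)
  have "\<exists>r>0. mball Q r \<subseteq> {Q \<in> nonempty_compacts. rational_hull Q \<inter> C = {}}"
    if Q: "Q \<in> nonempty_compacts" and disj: "rational_hull Q \<inter> C = {}" for Q
  proof (rule ccontr)
    assume "\<not> ?thesis"
    then have none: "\<forall>r. 0 < r \<longrightarrow> \<not> mball Q r \<subseteq> {Q \<in> nonempty_compacts. rational_hull Q \<inter> C = {}}"
      by simp
    have "\<exists>A. A \<in> nonempty_compacts \<and> hausdorff_dist Q A < inverse (real (Suc n)) \<and>
        (\<exists>z. z \<in> rational_hull A \<inter> C)" for n
    proof -
      have "\<not> mball Q (inverse (real (Suc n))) \<subseteq> {Q \<in> nonempty_compacts. rational_hull Q \<inter> C = {}}"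
        using none by (elim allE impE) simp_all
      then show ?thesis by auto
    qed
    then obtain A where "\<And>n. A n \<in> nonempty_compacts \<and>
        hausdorff_dist Q (A n) < inverse (real (Suc n)) \<and> (\<exists>z. z \<in> rational_hull (A n) \<inter> C)"
      by metis
    then have A: "\<And>n. A n \<in> nonempty_compacts" "\<And>n. hausdorff_dist Q (A n) < inverse (real (Suc n))"
      and hit: "\<And>n. \<exists>z. z \<in> rational_hull (A n) \<inter> C"
      by blast+
    obtain z where "\<And>n. z n \<in> rational_hull (A n) \<inter> C" using hit by metis
    then have z: "\<And>n. z n \<in> rational_hull (A n)" "\<And>n. z n \<in> C" by auto
    \<comment> \<open>The point \<open>z n\<close> may be far from \<open>Q\<close>, but it shares
      its \<open>f\<close>-value with a point \<open>x\<close> of \<open>A n\<close>, and the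
      Hausdorff distance places some \<open>y\<close> of \<open>Q\<close> next to
      \<open>x\<close>.\<close>
    have near: "\<exists>x y. peval f x = peval f (z n) \<and> y \<in> Q \<and> dist x y < inverse (real (Suc n))" for f n
    proof -
      have "A n \<noteq> {}" using A(1)[of n] by (simp add: nonempty_compacts_def)
      then obtain x where x: "x \<in> A n" "peval f x = peval f (z n)"
        using rational_hull_polynomial[OF z(1)] by metis
      have "hausdorff_dist (A n) Q < inverse (real (Suc n))"
        using A(2) by (simp only: hausdorff_dist_commute)
      from exists_close_point[OF A(1) Q x(1) this] show ?thesis using x(2) by blast
    qed
    have cQ: "compact Q" using Q by (simp add: nonempty_compacts_def)
    obtain B where B: "\<And>x. x \<in> Q \<Longrightarrow> norm x \<le> B"
      using compact_imp_bounded[OF cQ] by (auto simp: bounded_iff)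
    \<comment> \<open>Coordinate functions in place of \<open>f\<close> bound the sequence; points
      of \<open>A n\<close> are within distance 1 of \<open>Q\<close>, hence
      \<open>B + 1\<close>.\<close>
    have "z n \<in> cball 0 (real CARD('n) * (B + 1))" for n
    proof -
      have "norm (z n $ i) \<le> B + 1" for i
      proof -
        obtain x y where xy: "x $ i = z n $ i" "y \<in> Q" "dist x y < inverse (real (Suc n))"
          using near[of "Var i" n] by auto
        have "inverse (real (Suc n)) \<le> 1" by (simp add: inverse_le_1_iff)
        then have "norm x \<le> B + 1"
          using xy B[of y] norm_triangle_sub[of x y] by (simp add: dist_norm)
        then show ?thesis using Finite_Cartesian_Product.norm_nth_le[of x i] xy(1) by simp
      qed
      then have "norm (z n) \<le> real CARD('n) * (B + 1)" by (rule norm_le_of_components)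
      then show ?thesis by simp
    qed
    then have "\<forall>n. z n \<in> cball 0 (real CARD('n) * (B + 1))" by blast
    then obtain l s where l: "strict_mono s" "(z \<circ> s) \<longlonglongrightarrow> l"
      by (rule seq_compactE[OF compact_imp_seq_compact[OF compact_cball]])
    have "l \<in> C" using closed_sequentially[OF assms _ l(2)] z(2) by simp
    moreover have "l \<in> rational_hull Q"
    proof (rule polynomial_imp_rational_hull[OF cQ])
      fix f
      obtain x y where "\<And>n. peval f (x n) = peval f (z n) \<and> y n \<in> Q \<and>
          dist (x n) (y n) < inverse (real (Suc n))"
        using near[of f] by metis
      then have xy: "\<And>n. peval f (x n) = peval f (z n)" "\<And>n. y n \<in> Q"
        "\<And>n. norm (x n - y n) \<le> inverse (real (Suc n))"
        by (auto simp: dist_norm less_imp_le)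
      \<comment> \<open>The second subsequence \<open>t\<close> depends on \<open>f\<close>; the
        limit \<open>l\<close> was fixed before \<open>f\<close>.\<close>
      obtain l' t where t: "l' \<in> Q" "strict_mono t" "(y \<circ> s \<circ> t) \<longlonglongrightarrow> l'"
        using seq_compactE[OF compact_imp_seq_compact[OF cQ], of "y \<circ> s"] xy(2)
        by (metis comp_apply)
      have mono: "strict_mono (s \<circ> t)" using l(1) t(2) by (rule strict_mono_o)
      have lim: "(\<lambda>n. peval f (w n)) \<longlonglongrightarrow> peval f w'" if "w \<longlonglongrightarrow> w'" for w w'
        using continuous_on_tendsto_compose[OF continuous_on_peval[of UNIV f] that] by simp
      have "(\<lambda>n. x n - y n) \<longlonglongrightarrow> 0"
        using xy(3) by (intro Lim_null_comparison[OF _ LIMSEQ_inverse_real_of_nat] always_eventually allI)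
      from tendsto_add[OF LIMSEQ_subseq_LIMSEQ[OF this mono] t(3)]
      have "(x \<circ> (s \<circ> t)) \<longlonglongrightarrow> l'" by (simp add: o_def)
      from lim[OF this] have "(\<lambda>n. peval f (z (s (t n)))) \<longlonglongrightarrow> peval f l'"
        by (simp add: xy(1))
      moreover from lim[OF LIMSEQ_subseq_LIMSEQ[OF l(2) t(2)]]
      have "(\<lambda>n. peval f (z (s (t n)))) \<longlonglongrightarrow> peval f l" by simp
      ultimately have "peval f l' = peval f l" by (rule LIMSEQ_unique)
      then show "\<exists>x\<in>Q. peval f x = peval f l" using t(1) by blast
    qed
    ultimately show False using disj by blast
  qed
  then show ?thesis unfolding openin_mtopology by blast
qed

subsection \<open>Measurability of set-valued maps\<close>

text \<open>Closed balls are expressed through hitting or missing closed sets only. The open set of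
  points at distance more than \<open>e\<close> from \<open>F\<close> is a countable union of closed
  sets, hence the index \<open>n\<close>.\<close>

lemma hausdorff_dist_le_iff:
  assumes "F \<in> nonempty_compacts" "A \<in> nonempty_compacts"
  shows "hausdorff_dist F A \<le> e \<longleftrightarrow> (\<forall>y\<in>F. A \<inter> cball y e \<noteq> {}) \<and>
    (\<forall>n. A \<inter> {x. e + inverse (real (Suc n)) \<le> infdist x F} = {})"
proof -
  have A: "compact A" "A \<noteq> {}" using assms(2) by (auto simp: nonempty_compacts_def)
  have "hausdorff_dist F A \<le> e \<longleftrightarrow> (\<forall>y\<in>F. infdist y A \<le> e) \<and> (\<forall>x\<in>A. infdist x F \<le> e)"
    using infdist_le_hausdorff_dist[OF assms] infdist_le_hausdorff_dist[OF assms(2,1)]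
      hausdorff_dist_le[OF assms, of e] hausdorff_dist_commute[of F A] by fastforce
  moreover have "infdist y A \<le> e \<longleftrightarrow> A \<inter> cball y e \<noteq> {}" for y
  proof
    assume le: "infdist y A \<le> e"
    obtain a where "a \<in> A" "\<And>x. x \<in> A \<Longrightarrow> dist y a \<le> dist y x"
      using continuous_attains_inf[OF A, of "dist y"] continuous_on_dist[OF continuous_on_const continuous_on_id]
      by blast
    then have "a \<in> A" "dist y a \<le> infdist y A"
      using A(2) by (auto simp: infdist_notempty intro: cINF_greatest)
    then show "A \<inter> cball y e \<noteq> {}" using le by auto
  next
    assume "A \<inter> cball y e \<noteq> {}"
    then show "infdist y A \<le> e" using infdist_le2 by fastforce
  qed
  moreover have "infdist x F \<le> e \<longleftrightarrow> (\<forall>n. \<not> e + inverse (real (Suc n)) \<le> infdist x F)" for x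
  proof
    assume le: "infdist x F \<le> e"
    have "inverse (real (Suc n)) > 0" for n by simp
    then show "\<forall>n. \<not> e + inverse (real (Suc n)) \<le> infdist x F" using le by (smt (verit))
  next
    assume *: "\<forall>n. \<not> e + inverse (real (Suc n)) \<le> infdist x F"
    show "infdist x F \<le> e"
    proof (rule ccontr)
      assume "\<not> infdist x F \<le> e"
      then obtain n where "inverse (real (Suc n)) < infdist x F - e"
        using reals_Archimedean[of "infdist x F - e"] by auto
      then show False using * by (smt (verit))
    qed
  qed
  ultimately show ?thesis by auto
qed

text \<open>Compactness extracts a finite cover of \<open>A\<close> by balls centred in
  \<open>D\<close>. Thus the finite nonempty subsets of a dense set are dense for the Hausdorff
  distance.\<close>

lemma finite_approximation:
  fixes A :: "'a::metric_space set"
  assumes A: "A \<in> nonempty_compacts" and "e > 0"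
    and D: "\<And>X. open X \<Longrightarrow> X \<noteq> {} \<Longrightarrow> \<exists>d\<in>D. d \<in> X"
  shows "\<exists>F. finite F \<and> F \<subseteq> D \<and> F \<in> nonempty_compacts \<and> hausdorff_dist F A \<le> e"
proof -
  have cA: "compact A" "A \<noteq> {}" using A by (auto simp: nonempty_compacts_def)
  have "A \<subseteq> (\<Union>d\<in>D. ball d e)"
  proof
    fix x
    obtain d where "d \<in> D" "d \<in> ball x e" using D[of "ball x e"] \<open>e > 0\<close> by auto
    then show "x \<in> (\<Union>d\<in>D. ball d e)" by (auto simp: dist_commute)
  qed
  then obtain D' where D': "D' \<subseteq> D" "finite D'" "A \<subseteq> (\<Union>d\<in>D'. ball d e)"
    using compactE_image[OF cA(1), of D "\<lambda>d. ball d e"] by auto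
  \<comment> \<open>Centres whose balls miss \<open>A\<close> are dropped, so that \<open>F\<close>
    is also close to \<open>A\<close>.\<close>
  define F where "F = {d\<in>D'. ball d e \<inter> A \<noteq> {}}"
  have F: "finite F" "F \<subseteq> D" using D' by (auto simp: F_def)
  have cover: "\<exists>d\<in>F. dist d x < e" if "x \<in> A" for x using D'(3) that by (fastforce simp: F_def)
  then have F': "F \<in> nonempty_compacts"
    using F(1) cA(2) by (auto simp: nonempty_compacts_def finite_imp_compact)
  have "hausdorff_dist F A \<le> e"
  proof (rule hausdorff_dist_le[OF F' A])
    fix d assume "d \<in> F"
    then obtain x where "x \<in> A" "dist d x < e" by (auto simp: F_def)
    then show "infdist d A \<le> e" using infdist_le2 by fastforce
  next
    fix x assume "x \<in> A"
    then show "infdist x F \<le> e" using cover infdist_le2[of _ F x e] by (force simp: dist_commute)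
  qed
  then show ?thesis using F F' by blast
qed

text \<open>By separability every open set is a countable union of closed balls with finite centres
  and rational radii, and membership in such a ball is a countable combination of the given
  events.\<close>

lemma measurable_hausdorff_borel:
  fixes H :: "'w \<Rightarrow> 'a::{metric_space,second_countable_topology} set"
  assumes H: "\<And>\<omega>. \<omega> \<in> space M \<Longrightarrow> H \<omega> \<in> nonempty_compacts"
    and hit: "\<And>C. closed C \<Longrightarrow> {\<omega>\<in>space M. H \<omega> \<inter> C = {}} \<in> sets M"
  shows "H \<in> measurable M hausdorff_borel"
  unfolding hausdorff_borel_def
proof (rule measurable_measure_of)
  interpret Metric_space "nonempty_compacts :: 'a set set" hausdorff_dist
    by (rule Metric_space_hausdorff_dist)
  show "{\<U>. openin mtopology \<U>} \<subseteq> Pow (nonempty_compacts :: 'a set set)"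
    by (auto simp: openin_mtopology)
  show "H \<in> space M \<rightarrow> nonempty_compacts" using H by auto
  obtain D :: "'a set" where D: "countable D" "\<And>X. open X \<Longrightarrow> X \<noteq> {} \<Longrightarrow> \<exists>d\<in>D. d \<in> X"
    using countable_dense_exists[where 'a = 'a] by blast
  fix \<U> :: "'a set set" assume "\<U> \<in> {\<U>. openin mtopology \<U>}"
  then have U: "\<U> \<subseteq> nonempty_compacts" "\<And>A. A \<in> \<U> \<Longrightarrow> \<exists>r>0. mball A r \<subseteq> \<U>"
    by (auto simp: openin_mtopology)
  define I where "I = {(F, e). finite F \<and> F \<subseteq> D \<and> e \<in> \<rat> \<and> F \<in> nonempty_compacts \<and> mcball F e \<subseteq> \<U>}"
  have "countable I"
  proof (rule countable_subset)
    show "I \<subseteq> {F. finite F \<and> F \<subseteq> D} \<times> \<rat>" by (auto simp: I_def)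
    show "countable ({F. finite F \<and> F \<subseteq> D} \<times> \<rat>)"
      using countable_Collect_finite_subset[OF D(1)] countable_rat by blast
  qed
  have "\<U> = (\<Union>(F, e)\<in>I. mcball F e)"
  proof
    show "(\<Union>(F, e)\<in>I. mcball F e) \<subseteq> \<U>" by (auto simp: I_def)
    show "\<U> \<subseteq> (\<Union>(F, e)\<in>I. mcball F e)"
    proof
      fix A assume "A \<in> \<U>"
      then have A: "A \<in> nonempty_compacts" using U(1) by blast
      obtain r where r: "r > 0" "mball A r \<subseteq> \<U>" using U(2) \<open>A \<in> \<U>\<close> by blast
      \<comment> \<open>A closed ball of radius \<open>e\<close> that contains \<open>A\<close> has
        all its members within \<open>2 * e < r\<close> of \<open>A\<close>.\<close>
      obtain e where e: "e \<in> \<rat>" "0 < e" "e < r / 2" using Rats_dense_in_real[of 0 "r / 2"] r(1) by auto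
      obtain F where F: "finite F" "F \<subseteq> D" "F \<in> nonempty_compacts" "hausdorff_dist F A \<le> e"
        using finite_approximation[OF A e(2) D(2)] by blast
      have "mcball F e \<subseteq> mball A r"
        using F(3,4) A e(3) triangle[of A F] commute[of A F] by fastforce
      then have "(F, e) \<in> I" using F e(1) r(2) by (auto simp: I_def)
      moreover have "A \<in> mcball F e" using F A by simp
      ultimately show "A \<in> (\<Union>(F, e)\<in>I. mcball F e)" by blast
    qed
  qed
  then have "A \<in> \<U> \<longleftrightarrow> (\<exists>F e. (F, e) \<in> I \<and> A \<in> mcball F e)" for A by blast
  moreover have "A \<in> mcball F e \<longleftrightarrow> hausdorff_dist F A \<le> e" if "(F, e) \<in> I" "A \<in> nonempty_compacts" for F e A
    using that by (simp add: I_def)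
  ultimately have "H \<omega> \<in> \<U> \<longleftrightarrow> (\<exists>F e. (F, e) \<in> I \<and> hausdorff_dist F (H \<omega>) \<le> e)"
    if "\<omega> \<in> space M" for \<omega>
    using H[OF that] by blast
  then have "H -` \<U> \<inter> space M = (\<Union>(F, e)\<in>I. {\<omega>\<in>space M. hausdorff_dist F (H \<omega>) \<le> e})"
    by blast
  moreover have "{\<omega>\<in>space M. hausdorff_dist F (H \<omega>) \<le> e} \<in> sets M" if "(F, e) \<in> I" for F e
  proof -
    have F: "finite F" "F \<in> nonempty_compacts" using that by (auto simp: I_def)
    have "{\<omega>\<in>space M. hausdorff_dist F (H \<omega>) \<le> e} =
        {\<omega>\<in>space M. (\<forall>y\<in>F. \<not> H \<omega> \<inter> cball y e = {}) \<and>
          (\<forall>n. H \<omega> \<inter> {x. e + inverse (real (Suc n)) \<le> infdist x F} = {})}"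
      using hausdorff_dist_le_iff[OF F(2) H] by (intro Collect_cong conj_cong refl) simp
    \<comment> \<open>Hitting \<open>cball y e\<close> is the complement of a given event; only
      finitely many \<open>y\<close> and countably many \<open>n\<close> occur.\<close>
    also have "\<dots> \<in> sets M"
    proof (intro sets.sets_Collect_conj sets.sets_Collect_finite_All sets.sets_Collect_neg
          sets.sets_Collect_countable_All hit closed_cball F(1))
      show "closed {x. e + inverse (real (Suc n)) \<le> infdist x F}" for n
        by (intro closed_Collect_le continuous_intros)
    qed
    finally show ?thesis .
  qed
  ultimately show "H -` \<U> \<inter> space M \<in> sets M"
    using \<open>countable I\<close> by (auto intro!: sets.countable_UN')
qed

theorem theorem4p18:
  fixes M :: "'w measure" and K :: "'w \<Rightarrow> (complex ^ 'n) set"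
  assumes "random_compact_set M K"
  shows "random_compact_set M (\<lambda>\<omega>. rational_hull (K \<omega>))"
proof -
  have K: "K \<in> measurable M hausdorff_borel" using assms by (simp add: random_compact_set_def)
  have K': "K \<omega> \<in> nonempty_compacts" if "\<omega> \<in> space M" for \<omega>
    using measurable_space[OF K that] by (simp add: space_hausdorff_borel)
  have "{\<omega>\<in>space M. rational_hull (K \<omega>) \<inter> C = {}} \<in> sets M" if "closed C" for C
  proof -
    \<comment> \<open>The event is the preimage under \<open>K\<close> of this set, which is open by
      upper semicontinuity of the hull.\<close>
    have "{Q \<in> nonempty_compacts. rational_hull Q \<inter> C = {}} \<in> sets hausdorff_borel"
      unfolding hausdorff_borel_def
      using openin_rational_hull_disjoint[OF that]
        Metric_space.openin_mtopology[OF Metric_space_hausdorff_dist]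
      by (subst sets_measure_of) auto
    from measurable_sets[OF K this] show ?thesis
      using K' by (auto simp: vimage_def Int_def elim!: back_subst[of "\<lambda>A. A \<in> sets M"])
  qed
  then show ?thesis
    unfolding random_compact_set_def
    by (intro measurable_hausdorff_borel rational_hull_nonempty_compact K')
qed

end
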